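(* Let $n\ge5$ and consider all bicyclic graphs on $n$ vertices. (a) For $n=5$, the graph in $\mathbf B_3^{(1)}(5)$ and the graph in $\mathbf B_3^{(2)}(5)$ are respectively the unique graphs with the maximum and the second maximum sum--connectivity index. (b) For $n=6$, the graphs in $\mathbf B_1^{(1)}(6)\cup\mathbf B_3^{(1)}(6)$ are exactly the graphs with the maximum sum--connectivity index, and the graph in $\mathbf B_3^{(2)}(6)$ is the unique graph with the second maximum. (c) For $n\ge7$, the graphs in $\mathbf B_1^{(1)}(n)\cup\mathbf B_3^{(1)}(n)$ are exactly the graphs with the maximum sum--connectivity index, and the graphs in $\mathbf B_1^{(2)}(n)\cup\mathbf B_3^{(2)}(n)$ are exactly the graphs with the second maximum. Here $\chi(G)=\frac{n-4}{2}+\frac{1}{\sqrt6}+\frac{4}{\sqrt5}$ for $G\in\mathbf B_1^{(1)}(n)\cup\mathbf B_3^{(1)}(n)$ and $\chi(H)=\frac{n-5}{2}+\frac{6}{\sqrt5}$ for $H\in\mathbf B_1^{(2)}(n)\cup\mathbf B_3^{(2)}(n)$.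
   Context: All graphs are simple. For a graph $G$, $d_G(u)$ is the degree of $u$. The sum--connectivity index is $\chi(G)=\sum_{uv\in E(G)}\frac{1}{\sqrt{d_G(u)+d_G(v)}}$. A bicyclic graph is a connected graph with $n$ vertices and $n+1$ edges. $C_k$ is the cycle on $k$ vertices. $\mathbf B_1^{(1)}(n)$ ($n\ge6$): graphs obtained by joining two vertex-disjoint cycles $C_a$, $C_b$ with $a+b=n$ by an edge. $\mathbf B_1^{(2)}(n)$ ($n\ge7$): graphs obtained by joining two vertex-disjoint cycles $C_a$, $C_b$ with $a+b<n$ by a path of length $n-a-b+1$ between a vertex of $C_a$ and a vertex of $C_b$. $\mathbf B_3^{(1)}(n)$ ($n\ge4$): graphs obtained from $C_n$ by adding one edge. $\mathbf B_3^{(2)}(n)$ ($n\ge5$): graphs obtained by joining two non-adjacent vertices of a cycle $C_a$, $4\le a\le n-1$, by a path of length $n-a+1$ (whose internal vertices are new). *)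

theory Defs
  imports Complex_Main
begin

datatype 'a ugraph = UGraph (verts: "'a set") (edges: "'a set set")

definition simple_graph :: "'a ugraph \<Rightarrow> bool" where
  "simple_graph G \<longleftrightarrow> finite (verts G) \<and> (\<forall>e \<in> edges G. e \<subseteq> verts G \<and> card e = 2)"

definition degree :: "'a ugraph \<Rightarrow> 'a \<Rightarrow> nat" where
  "degree G u = card {e \<in> edges G. u \<in> e}"

text \<open>Edges are two-element sets, so the inner sum is the sum of the degrees of the two
  endpoints of the edge.\<close>

definition sum_connectivity :: "'a ugraph \<Rightarrow> real" where
  "sum_connectivity G = (\<Sum>e \<in> edges G. 1 / sqrt (\<Sum>u \<in> e. real (degree G u)))"

definition connected_graph :: "'a ugraph \<Rightarrow> bool" where
  "connected_graph G \<longleftrightarrow> verts G \<noteq> {} \<and>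
     (\<forall>u \<in> verts G. \<forall>v \<in> verts G. (u, v) \<in> {(x, y). {x, y} \<in> edges G}\<^sup>*)"

definition bicyclic :: "nat \<Rightarrow> 'a ugraph \<Rightarrow> bool" where
  "bicyclic n G \<longleftrightarrow> simple_graph G \<and> connected_graph G \<and>
     card (verts G) = n \<and> card (edges G) = n + 1"

definition graph_iso :: "'a ugraph \<Rightarrow> 'b ugraph \<Rightarrow> bool" where
  "graph_iso G H \<longleftrightarrow> (\<exists>f. bij_betw f (verts G) (verts H) \<and> edges H = (\<lambda>e. f ` e) ` edges G)"

definition unique_up_to_iso :: "'a ugraph set \<Rightarrow> bool" where
  "unique_up_to_iso S \<longleftrightarrow> S \<noteq> {} \<and> (\<forall>G \<in> S. \<forall>H \<in> S. graph_iso G H)"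

definition graph_union :: "'a ugraph \<Rightarrow> 'a ugraph \<Rightarrow> 'a ugraph" where
  "graph_union G H = UGraph (verts G \<union> verts H) (edges G \<union> edges H)"

definition add_edge :: "'a ugraph \<Rightarrow> 'a \<Rightarrow> 'a \<Rightarrow> 'a ugraph" where
  "add_edge G u v = UGraph (verts G) (insert {u, v} (edges G))"

definition is_cycle :: "nat \<Rightarrow> 'a ugraph \<Rightarrow> bool" where
  "is_cycle k C \<longleftrightarrow> k \<ge> 3 \<and>
     (\<exists>xs. distinct xs \<and> length xs = k \<and>
        C = UGraph (set xs) {{xs ! i, xs ! (Suc i mod k)} | i. i < k})"

text \<open>The length \<open>l\<close> of a path is its number of edges.\<close>

definition is_path :: "nat \<Rightarrow> 'a \<Rightarrow> 'a \<Rightarrow> 'a ugraph \<Rightarrow> bool" where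
  "is_path l u v P \<longleftrightarrow>
     (\<exists>xs. distinct xs \<and> length xs = Suc l \<and> xs ! 0 = u \<and> xs ! l = v \<and>
        P = UGraph (set xs) {{xs ! i, xs ! Suc i} | i. i < l})"

text \<open>The following four families consist of all graphs with vertices in the ambient type
  that arise by the respective construction, so each is closed under isomorphism within
  that type. The lower bounds on \<open>n\<close> for which they are considered need not be imposed:
  since cycles have at least three vertices, the families are empty for smaller \<open>n\<close>.\<close>

definition B1_1 :: "nat \<Rightarrow> 'a ugraph set" where
  "B1_1 n = {G. \<exists>a b C D u v. is_cycle a C \<and> is_cycle b D \<and> a + b = n \<and>
      verts C \<inter> verts D = {} \<and> u \<in> verts C \<and> v \<in> verts D \<and>
      G = add_edge (graph_union C D) u v}"

definition B1_2 :: "nat \<Rightarrow> 'a ugraph set" where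
  "B1_2 n = {G. \<exists>a b C D P u v. is_cycle a C \<and> is_cycle b D \<and> a + b < n \<and>
      verts C \<inter> verts D = {} \<and> is_path (n - a - b + 1) u v P \<and>
      verts P \<inter> verts C = {u} \<and> verts P \<inter> verts D = {v} \<and>
      G = graph_union (graph_union C D) P}"

definition B3_1 :: "nat \<Rightarrow> 'a ugraph set" where
  "B3_1 n = {G. \<exists>C u v. is_cycle n C \<and> u \<in> verts C \<and> v \<in> verts C \<and> u \<noteq> v \<and>
      {u, v} \<notin> edges C \<and> G = add_edge C u v}"

definition B3_2 :: "nat \<Rightarrow> 'a ugraph set" where
  "B3_2 n = {G. \<exists>a C P u v. 4 \<le> a \<and> a \<le> n - 1 \<and> is_cycle a C \<and>
      u \<in> verts C \<and> v \<in> verts C \<and> u \<noteq> v \<and> {u, v} \<notin> edges C \<and>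
      is_path (n - a + 1) u v P \<and> verts P \<inter> verts C = {u, v} \<and>
      G = graph_union C P}"

definition max_graphs :: "nat \<Rightarrow> 'a ugraph set" where
  "max_graphs n = {G. is_arg_max sum_connectivity (bicyclic n) G}"

text \<open>The second maximum is the largest value below the maximum, that is, the maximum over
  the bicyclic graphs that do not attain the maximum.\<close>

definition second_max_graphs :: "nat \<Rightarrow> 'a ugraph set" where
  "second_max_graphs n =
     {G. is_arg_max sum_connectivity (\<lambda>H. bicyclic n H \<and> H \<notin> max_graphs n) G}"

end

(* Writing the weight 1/sqrt(a+b) of an edge as at most 9/40 + 11/40 (1/a + 1/b), with slack 1/20 at
   a pendant edge, and summing (the terms 1/a + 1/b add up to n over all edges) gives
   chi(G) <= n/2 + 7/40 for a bicyclic graph with a pendant vertex. A bicyclic graph of minimum degree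
   at least 2 has degree excess 2 over 2-regularity, so it has either one vertex of degree 4 or two
   vertices u, v of degree 3; in each case chi is explicit, and in the latter it depends only on n and
   on whether u and v are adjacent. Deleting the edges and the interior vertices of a u-v path from a
   graph of the latter kind leaves a 2-regular graph every component of which contains u or v,
   that is, one cycle through both or two disjoint cycles: these are the four families. *)

theory Submission
  imports Defs
begin

text \<open>The coefficients 9/40 and 11/40 add up to 1/2, so the edge bound is tight for degrees 2
  and 2, the prevailing edges of the best graphs. Without slack it sums to n/2 + 9/40, which is too
  weak: the second largest value is about n/2 + 0.183. The slack 1/20 on a single pendant edge
  brings it down to n/2 + 0.175, just enough. A vertex of degree 4 gives only about n/2 + 0.133. The
  four families differ in two independent ways: the path is attached to one cycle or to two, and it
  has one edge or more. Hence the parametrisation by path length in \<open>theta_graphs\<close> and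
  \<open>dumbbell_graphs\<close>, where length 1 means that the cubic vertices are adjacent. For
  adjacent cubic vertices the deleted path has to be their edge itself: a longer path would leave
  that edge in the remaining cycle, which the families forbid. Uniqueness for n = 5 and n = 6 is a
  matter of partitions of n - 2, because a theta graph is determined up to isomorphism by the
  numbers of interior vertices of its three paths.\<close>

abbreviation valency :: "'a set set \<Rightarrow> 'a \<Rightarrow> nat" where
  "valency E x \<equiv> card {e \<in> E. x \<in> e}"

text \<open>The relation inside \<open>connected_graph\<close>, as a function of the edge set alone,
  so that reachability in a graph and in its subgraphs can be compared.\<close>

definition adj :: "'a set set \<Rightarrow> ('a \<times> 'a) set" where
  "adj E = {(x, y). {x, y} \<in> E}"

lemma adj_iff [simp]: "(x, y) \<in> adj E \<longleftrightarrow> {x, y} \<in> E"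
  by (simp add: adj_def)

section \<open>Edge sets of paths and cycles given by vertex lists\<close>

fun path_edges :: "'a list \<Rightarrow> 'a set set" where
  "path_edges (x # y # zs) = insert {x, y} (path_edges (y # zs))"
| "path_edges _ = {}"

text \<open>On one vertex the closing pair collapses to a singleton, and on two it repeats the path
  edge. Hence the bound \<open>length xs \<ge> 3\<close> in the counting lemmas.\<close>

definition cycle_edges :: "'a list \<Rightarrow> 'a set set" where
  "cycle_edges xs = insert {last xs, hd xs} (path_edges xs)"

text \<open>Bridge to the indexed edge sets of \<open>is_path\<close> and \<open>is_cycle\<close>.
  The recursive form is the one that supports induction and concatenation.\<close>

lemma path_edges_nth: "path_edges xs = {{xs ! i, xs ! Suc i} | i. Suc i < length xs}"
proof (induction xs rule: path_edges.induct)
  case (1 x y zs)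
  have "{{(x # y # zs) ! i, (x # y # zs) ! Suc i} | i. Suc i < length (x # y # zs)}
      = insert {x, y} {{(y # zs) ! i, (y # zs) ! Suc i} | i. Suc i < length (y # zs)}"
    (is "?L = ?R")
  proof (intro equalityI subsetI)
    fix e assume "e \<in> ?L"
    then obtain i where "Suc i < length (x # y # zs)"
      "e = {(x # y # zs) ! i, (x # y # zs) ! Suc i}" by blast
    then show "e \<in> ?R" by (cases i) auto
  next
    fix e assume "e \<in> ?R"
    then consider "e = {x, y}"
      | i where "Suc i < length (y # zs)" "e = {(y # zs) ! i, (y # zs) ! Suc i}" by blast
    then show "e \<in> ?L"
    proof cases
      case 1
      then show ?thesis by (intro CollectI exI[of _ 0]) auto
    next
      case (2 i)
      then show ?thesis by (intro CollectI exI[of _ "Suc i"]) auto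
    qed
  qed
  with 1 show ?case by simp
qed auto

lemma cycle_edges_nth:
  assumes "xs \<noteq> []"
  shows "cycle_edges xs = {{xs ! i, xs ! (Suc i mod length xs)} | i. i < length xs}" (is "_ = ?R")
proof (intro equalityI subsetI)
  fix e assume "e \<in> cycle_edges xs"
  then consider "e = {last xs, hd xs}"
    | i where "Suc i < length xs" "e = {xs ! i, xs ! Suc i}"
    unfolding cycle_edges_def path_edges_nth by blast
  then show "e \<in> ?R"
  proof cases
    case 1
    then show ?thesis using assms
      by (intro CollectI exI[of _ "length xs - 1"]) (auto simp: last_conv_nth hd_conv_nth)
  next
    case (2 i)
    then show ?thesis by (intro CollectI exI[of _ i]) auto
  qed
next
  fix e assume "e \<in> ?R"
  then obtain i where i: "i < length xs" "e = {xs ! i, xs ! (Suc i mod length xs)}" by blast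
  show "e \<in> cycle_edges xs"
  proof (cases "Suc i < length xs")
    case True
    then show ?thesis using i unfolding cycle_edges_def path_edges_nth by auto
  next
    case False
    then have "Suc i = length xs" using i by simp
    then have "e = {last xs, hd xs}" using i assms
      by (metis diff_Suc_1 hd_conv_nth last_conv_nth mod_self)
    then show ?thesis unfolding cycle_edges_def by simp
  qed
qed

lemma is_cycle_iff:
  "is_cycle k C \<longleftrightarrow> k \<ge> 3 \<and>
     (\<exists>xs. distinct xs \<and> length xs = k \<and> C = UGraph (set xs) (cycle_edges xs))"
proof -
  have "{{xs ! i, xs ! (Suc i mod k)} | i. i < k} = cycle_edges xs"
    if "k \<ge> 3" "length xs = k" for xs :: "'a list"
    using cycle_edges_nth[of xs] that by (cases "xs = []") auto
  then show ?thesis unfolding is_cycle_def by (intro conj_cong ex_cong1) auto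
qed

lemma is_path_iff:
  "is_path l u v P \<longleftrightarrow> (\<exists>xs. distinct xs \<and> length xs = Suc l \<and> hd xs = u \<and> last xs = v \<and>
     P = UGraph (set xs) (path_edges xs))"
proof -
  have "xs ! 0 = hd xs \<and> xs ! l = last xs \<and> {{xs ! i, xs ! Suc i} | i. i < l} = path_edges xs"
    if "length xs = Suc l" for xs :: "'a list"
  proof -
    from that have "xs \<noteq> []" by auto
    with that show ?thesis by (auto simp: path_edges_nth hd_conv_nth last_conv_nth)
  qed
  then show ?thesis unfolding is_path_def by (intro ex_cong1) auto
qed

lemma path_edges_append:
  "xs \<noteq> [] \<Longrightarrow> ys \<noteq> [] \<Longrightarrow>
     path_edges (xs @ ys) = insert {last xs, hd ys} (path_edges xs \<union> path_edges ys)"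
proof (induction xs rule: path_edges.induct)
  case ("2_2" v)
  then show ?case by (cases ys) auto
qed auto

lemma path_edges_rev: "path_edges (rev xs) = path_edges xs"
proof (induction xs rule: path_edges.induct)
  case (1 x y zs)
  have "path_edges (rev (x # y # zs)) = insert {last (rev (y # zs)), x} (path_edges (rev (y # zs)))"
    using path_edges_append[of "rev (y # zs)" "[x]"] by simp
  also have "last (rev (y # zs)) = y" by simp
  finally show ?case using 1 by (simp add: insert_commute)
qed auto

lemma path_edges_subset: "e \<in> path_edges xs \<Longrightarrow> e \<subseteq> set xs"
  by (induction xs rule: path_edges.induct) auto

lemma finite_path_edges [simp]: "finite (path_edges xs)"
  by (induction xs rule: path_edges.induct) auto

lemma path_edges_map: "path_edges (map f xs) = (`) f ` path_edges xs"
  by (induction xs rule: path_edges.induct) auto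

lemma valency_insert:
  "finite E \<Longrightarrow> e \<notin> E \<Longrightarrow> valency (insert e E) x = valency E x + of_bool (x \<in> e)"
proof -
  assume "finite E" "e \<notin> E"
  moreover have "{e' \<in> insert e E. x \<in> e'} =
      (if x \<in> e then insert e {e' \<in> E. x \<in> e'} else {e' \<in> E. x \<in> e'})" by auto
  ultimately show ?thesis by simp
qed

lemma valency_Un:
  assumes "finite E" "finite F" "E \<inter> F = {}"
  shows "valency (E \<union> F) x = valency E x + valency F x"
proof -
  have "{e \<in> E \<union> F. x \<in> e} = {e \<in> E. x \<in> e} \<union> {e \<in> F. x \<in> e}" by auto
  then show ?thesis using assms by (simp add: card_Un_disjoint disjoint_iff)
qed

lemma hd_edge_notin: "distinct (x # y # zs) \<Longrightarrow> {x, y} \<notin> path_edges (y # zs)"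
  using path_edges_subset by fastforce

lemma card_path_edges: "distinct xs \<Longrightarrow> card (path_edges xs) = length xs - 1"
proof (induction xs rule: path_edges.induct)
  case (1 x y zs)
  then show ?case using hd_edge_notin[OF 1(2)] by simp
qed auto

lemma path_edges_card2: "distinct xs \<Longrightarrow> e \<in> path_edges xs \<Longrightarrow> card e = 2"
  by (induction xs rule: path_edges.induct) auto

text \<open>The end corrections stand on the left to avoid truncated subtraction. The equation then
  also covers the one-vertex path, where both corrections fall on the same vertex.\<close>

lemma valency_path_edges:
  "distinct xs \<Longrightarrow> xs \<noteq> [] \<Longrightarrow>
     valency (path_edges xs) z + of_bool (z = hd xs) + of_bool (z = last xs) = 2 * of_bool (z \<in> set xs)"
proof (induction xs rule: path_edges.induct)
  case (1 x y zs)
  have "valency (path_edges (x # y # zs)) z = valency (path_edges (y # zs)) z + of_bool (z \<in> {x, y})"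
    using valency_insert[OF finite_path_edges hd_edge_notin[OF 1(2)], of z] by simp
  then show ?case using 1 by (auto simp: of_bool_def split: if_splits)
qed auto

text \<open>Only the first edge contains \<open>hd xs\<close>, and its other end is the second
  vertex, which is not the last one once there are three.\<close>

lemma last_edge_notin:
  assumes "distinct xs" "length xs \<ge> 3"
  shows "{last xs, hd xs} \<notin> path_edges xs"
proof -
  obtain x y zs where xs: "xs = x # y # zs" "zs \<noteq> []"
    using assms(2) by (cases xs; cases "tl xs"; cases "tl (tl xs)") auto
  then have l: "last xs = last zs" "last zs \<in> set zs" by simp_all
  then show ?thesis using assms(1) xs path_edges_subset[of "{last zs, x}" "y # zs"]
    by (auto simp: doubleton_eq_iff)
qed

lemma card_cycle_edges: "distinct xs \<Longrightarrow> length xs \<ge> 3 \<Longrightarrow> card (cycle_edges xs) = length xs"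
  using last_edge_notin[of xs] by (simp add: cycle_edges_def card_path_edges)

lemma cycle_edges_subset: "xs \<noteq> [] \<Longrightarrow> e \<in> cycle_edges xs \<Longrightarrow> e \<subseteq> set xs"
  unfolding cycle_edges_def using path_edges_subset by fastforce

lemma hd_neq_last: "distinct xs \<Longrightarrow> length xs \<ge> 2 \<Longrightarrow> hd xs \<noteq> last xs"
  by (cases xs) auto

lemma cycle_edges_card2:
  assumes "distinct xs" "length xs \<ge> 3" "e \<in> cycle_edges xs"
  shows "card e = 2"
  using assms hd_neq_last[of xs] path_edges_card2[of xs e] unfolding cycle_edges_def by auto

lemma valency_cycle_edges:
  assumes "distinct xs" "length xs \<ge> 3"
  shows "valency (cycle_edges xs) z = 2 * of_bool (z \<in> set xs)"
proof -
  have "xs \<noteq> []" using assms by auto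
  then show ?thesis
    using valency_insert[OF finite_path_edges last_edge_notin[OF assms], of z]
      valency_path_edges[OF assms(1), of z] hd_neq_last[of xs] assms
    unfolding cycle_edges_def by (auto simp: of_bool_def split: if_splits)
qed

section \<open>Reachability and connectedness\<close>

lemma adj_rtrancl_sym: "(x, y) \<in> (adj E)\<^sup>* \<Longrightarrow> (y, x) \<in> (adj E)\<^sup>*"
proof -
  have "sym (adj E)" by (auto simp: sym_def insert_commute)
  then show "(x, y) \<in> (adj E)\<^sup>* \<Longrightarrow> (y, x) \<in> (adj E)\<^sup>*" by (meson sym_rtrancl symD)
qed

lemma adj_rtrancl_mono: "(x, y) \<in> (adj E)\<^sup>* \<Longrightarrow> E \<subseteq> F \<Longrightarrow> (x, y) \<in> (adj F)\<^sup>*"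
proof -
  assume "(x, y) \<in> (adj E)\<^sup>*" "E \<subseteq> F"
  moreover from this have "adj E \<subseteq> adj F" by auto
  ultimately show ?thesis using rtrancl_mono by blast
qed

lemma path_edges_reach_hd: "x \<in> set xs \<Longrightarrow> (hd xs, x) \<in> (adj (path_edges xs))\<^sup>*"
proof (induction xs rule: path_edges.induct)
  case (1 a y zs)
  show ?case
  proof (cases "x = a")
    case False
    with 1 have "(y, x) \<in> (adj (path_edges (y # zs)))\<^sup>*" by simp
    then have "(y, x) \<in> (adj (path_edges (a # y # zs)))\<^sup>*"
      by (rule adj_rtrancl_mono) auto
    moreover have "(a, y) \<in> adj (path_edges (a # y # zs))" by simp
    ultimately have "(a, x) \<in> (adj (path_edges (a # y # zs)))\<^sup>*"
      by (meson converse_rtrancl_into_rtrancl)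
    then show ?thesis by (metis list.sel(1))
  qed simp
qed auto

lemma connected_graph_iff:
  assumes "r \<in> verts G"
  shows "connected_graph G \<longleftrightarrow> (\<forall>x \<in> verts G. (r, x) \<in> (adj (edges G))\<^sup>*)"
proof
  assume "connected_graph G"
  then show "\<forall>x \<in> verts G. (r, x) \<in> (adj (edges G))\<^sup>*"
    using assms unfolding connected_graph_def adj_def by blast
next
  assume r: "\<forall>x \<in> verts G. (r, x) \<in> (adj (edges G))\<^sup>*"
  have "(x, y) \<in> (adj (edges G))\<^sup>*" if "x \<in> verts G" "y \<in> verts G" for x y
    using r that by (meson adj_rtrancl_sym rtrancl_trans)
  then show "connected_graph G"
    using assms unfolding connected_graph_def adj_def by blast
qed

lemma connected_path:
  assumes "xs \<noteq> []"
  shows "connected_graph (UGraph (set xs) (path_edges xs))"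
proof -
  have "hd xs \<in> verts (UGraph (set xs) (path_edges xs))" using assms by simp
  from connected_graph_iff[OF this] show ?thesis
    by (simp add: path_edges_reach_hd)
qed

lemma connected_cycle:
  assumes "xs \<noteq> []"
  shows "connected_graph (UGraph (set xs) (cycle_edges xs))"
proof -
  have "hd xs \<in> verts (UGraph (set xs) (cycle_edges xs))" using assms by simp
  from connected_graph_iff[OF this] show ?thesis
    by (simp add: adj_rtrancl_mono[OF path_edges_reach_hd] cycle_edges_def subset_insertI)
qed

lemma connected_union:
  assumes "connected_graph G" "connected_graph H" "w \<in> verts G" "w \<in> verts H"
  shows "connected_graph (graph_union G H)"
proof -
  have *: "(w, x) \<in> (adj (edges G \<union> edges H))\<^sup>*" if "x \<in> verts G \<union> verts H" for x
  proof (cases "x \<in> verts G")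
    case True
    then have "(w, x) \<in> (adj (edges G))\<^sup>*" using assms connected_graph_iff[OF assms(3)] by simp
    then show ?thesis by (rule adj_rtrancl_mono) auto
  next
    case False
    then have "(w, x) \<in> (adj (edges H))\<^sup>*" using assms connected_graph_iff[OF assms(4)] that by simp
    then show ?thesis by (rule adj_rtrancl_mono) auto
  qed
  have "w \<in> verts (graph_union G H)" using assms by (simp add: graph_union_def)
  from connected_graph_iff[OF this] show ?thesis using * by (simp add: graph_union_def)
qed

section \<open>Double counting and the bound for graphs with a pendant vertex\<close>

lemma simple_graphD:
  assumes "simple_graph G"
  shows "finite (verts G)" "finite (edges G)"
    "e \<in> edges G \<Longrightarrow> e \<subseteq> verts G" "e \<in> edges G \<Longrightarrow> card e = 2" "e \<in> edges G \<Longrightarrow> finite e"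
proof -
  show fin: "finite (verts G)" using assms by (simp add: simple_graph_def)
  have "edges G \<subseteq> Pow (verts G)" using assms by (auto simp: simple_graph_def)
  then show "finite (edges G)" by (rule finite_subset) (simp add: fin)
  show "e \<in> edges G \<Longrightarrow> e \<subseteq> verts G" "e \<in> edges G \<Longrightarrow> card e = 2"
    using assms by (auto simp: simple_graph_def)
  then show "e \<in> edges G \<Longrightarrow> finite e" using fin by (auto intro: finite_subset)
qed

text \<open>Double counting of incidences. It is used with \<open>g\<close> the reciprocal degree,
  where the right side counts the vertices, and with \<open>g\<close> constantly 1, where it is the
  degree sum.\<close>

lemma handshake:
  fixes g :: "'a \<Rightarrow> real"
  assumes "simple_graph G"
  shows "(\<Sum>e\<in>edges G. \<Sum>w\<in>e. g w) = (\<Sum>w\<in>verts G. real (degree G w) * g w)"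
proof -
  note G = simple_graphD[OF assms]
  have "(\<Sum>e\<in>edges G. \<Sum>w\<in>e. g w) = (\<Sum>e\<in>edges G. \<Sum>w\<in>verts G. if w \<in> e then g w else 0)"
  proof (rule sum.cong)
    fix e assume "e \<in> edges G"
    then have "verts G \<inter> e = e" using G(3) by auto
    then show "(\<Sum>w\<in>e. g w) = (\<Sum>w\<in>verts G. if w \<in> e then g w else 0)"
      using sum.inter_restrict[OF G(1), of g e] by simp
  qed simp
  also have "\<dots> = (\<Sum>w\<in>verts G. \<Sum>e\<in>edges G. if w \<in> e then g w else 0)"
    by (rule sum.swap)
  also have "\<dots> = (\<Sum>w\<in>verts G. real (degree G w) * g w)"
  proof (rule sum.cong)
    fix w
    have "(\<Sum>e\<in>edges G. if w \<in> e then g w else 0) = (\<Sum>e\<in>{e \<in> edges G. w \<in> e}. g w)"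
      using sum.inter_filter[OF G(2), of "\<lambda>_. g w" "\<lambda>e. w \<in> e"] by simp
    then show "(\<Sum>e\<in>edges G. if w \<in> e then g w else 0) = real (degree G w) * g w"
      by (simp add: degree_def)
  qed simp
  finally show ?thesis .
qed

text \<open>Reduces a rational upper bound on a reciprocal square root to rational
  arithmetic.\<close>

lemma inv_sqrt_le:
  fixes q s :: real
  assumes "q > 0" "1 \<le> q^2 * s"
  shows "1 / sqrt s \<le> q"
proof -
  have "1 / q \<le> sqrt s"
    using assms by (intro real_le_rsqrt) (simp add: field_simps)
  moreover have "0 < 1 / q" using assms by simp
  ultimately have "0 < sqrt s" by linarith
  then show ?thesis using \<open>1 / q \<le> sqrt s\<close> assms by (simp add: field_simps)
qed

text \<open>For b >= 4 the constant part 9/40 + 11/40 - 1/20 = 9/20 suffices, since (9/20)^2 * 5 =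
  81/80. The rationals 29/40 and 47/80 are the right side at b = 1 and b = 2; at b = 3 the left side
  is exactly 1/2.\<close>

lemma inv_sqrt_bound_pendant:
  assumes "b \<ge> (1::nat)"
  shows "1 / sqrt (1 + real b) \<le> 9/40 + 11/40 * (1 + 1 / real b) - 1/20"
proof -
  consider "b = 1" | "b = 2" | "b = 3" | "b \<ge> 4" using assms by linarith
  then show ?thesis
  proof cases
    case 4
    then have "1 / sqrt (1 + real b) \<le> 9/20"
      by (intro inv_sqrt_le) (auto simp: power2_eq_square)
    also have "\<dots> \<le> 9/20 + 11/40 * (1 / real b)" by simp
    also have "\<dots> = 9/40 + 11/40 * (1 + 1 / real b) - 1/20" by (simp only: ring_distribs)
    finally show ?thesis .
  next
    case 1
    then show ?thesis using inv_sqrt_le[of "29/40" 2] by (simp add: power2_eq_square)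
  next
    case 2
    then show ?thesis using inv_sqrt_le[of "47/80" 3] by (simp add: power2_eq_square)
  next
    case 3
    then show ?thesis by simp
  qed
qed

text \<open>Put s = a + b and x = 1 / sqrt s. Since 1/a + 1/b >= 4/s = 4 x^2, it is enough that
  11/10 x^2 - x + 9/40 >= 0. The roots of this quadratic are 1/2 and 9/22, which correspond to s = 4
  and to s = 484/81, just below 6. So the argument covers s >= 6, and with pendant edges already
  settled only the degrees 2, 2 and 2, 3 are left.\<close>

lemma inv_sqrt_bound:
  fixes a b :: nat
  assumes "a \<ge> 1" "b \<ge> 1"
  shows "1 / sqrt (real a + real b) \<le> 9/40 + 11/40 * (1 / real a + 1 / real b)"
proof -
  consider "a = 1" | "b = 1" | "a = 2" "b = 2" | "a = 2" "b = 3" | "a = 3" "b = 2" | "a + b \<ge> 6"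
    using assms by linarith
  then show ?thesis
  proof cases
    case 1
    then show ?thesis using inv_sqrt_bound_pendant[OF assms(2)] by simp
  next
    case 2
    then show ?thesis using inv_sqrt_bound_pendant[OF assms(1)] by (simp add: add.commute)
  next
    case 6
    define s where "s = real a + real b"
    define x where "x = 1 / sqrt s"
    have s: "s \<ge> 6" using 6 unfolding s_def by linarith
    have x2: "x^2 = 1 / s" using s by (simp add: x_def power_divide)
    have "x \<le> 9/22" unfolding x_def using s by (intro inv_sqrt_le) (auto simp: power2_eq_square)
    then have "0 \<le> (1/2 - x) * (9/22 - x)" by (intro mult_nonneg_nonneg) auto
    moreover have "(1/2 - x) * (9/22 - x) = 9/44 - 10/11 * x + x^2"
      by (simp add: field_simps power2_eq_square)
    ultimately have "x \<le> 9/40 + 11/10 * x^2" by linarith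
    moreover have "4 * x^2 \<le> 1 / real a + 1 / real b"
    proof -
      have "0 \<le> (real a - real b)^2" by simp
      then show ?thesis using assms unfolding x2 s_def
        by (simp add: field_simps power2_eq_square)
    qed
    then have "11/40 * (4 * x^2) \<le> 11/40 * (1 / real a + 1 / real b)"
      by (rule mult_left_mono) simp
    ultimately have "x \<le> 9/40 + 11/40 * (1 / real a + 1 / real b)" by linarith
    then show ?thesis unfolding x_def s_def .
  \<comment> \<open>109/240 is the right side for degrees 2 and 3; for degrees 2 and 2 both sides
    equal 1/2.\<close>
  qed (use inv_sqrt_le[of "109/240" 5] in \<open>simp_all add: power2_eq_square\<close>)
qed

lemma degree_pos:
  assumes "simple_graph G" "connected_graph G" "card (verts G) \<ge> 2" "x \<in> verts G"
  shows "degree G x \<ge> 1"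
proof -
  have "verts G \<noteq> {x}" using assms(3) by auto
  then obtain y where y: "y \<in> verts G" "y \<noteq> x" using assms(4) by blast
  have "(x, y) \<in> (adj (edges G))\<^sup>*" using assms(2) connected_graph_iff[OF assms(4)] y by blast
  then obtain z where "{x, z} \<in> edges G"
    using y(2) by (cases rule: converse_rtranclE) auto
  then have "{x, z} \<in> {e \<in> edges G. x \<in> e}" by simp
  then have "{e \<in> edges G. x \<in> e} \<noteq> {}" by blast
  moreover have "finite {e \<in> edges G. x \<in> e}" using simple_graphD(2)[OF assms(1)] by simp
  ultimately have "card {e \<in> edges G. x \<in> e} > 0" by (simp only: card_gt_0_iff) simp
  then show ?thesis unfolding degree_def by simp
qed

text \<open>The slack is claimed only at the edge \<open>e0\<close> of the one pendant vertex
  \<open>v\<close>. The total is then 9/40 * (n + 1) + 11/40 * n - 1/20.\<close>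

lemma sum_connectivity_pendant:
  assumes "bicyclic n G" "n \<ge> 2" "v \<in> verts G" "degree G v \<le> 1"
  shows "sum_connectivity G \<le> real n / 2 + 7/40"
proof -
  have G: "simple_graph G" "connected_graph G" "card (verts G) = n" "card (edges G) = n + 1"
    using assms(1) by (simp_all add: bicyclic_def)
  note S = simple_graphD[OF G(1)]
  have pos: "degree G x \<ge> 1" if "x \<in> verts G" for x
    using degree_pos[OF G(1,2) _ that] G(3) assms(2) by simp
  have dv: "degree G v = 1" using pos[OF assms(3)] assms(4) by simp
  then obtain e0 where "{e \<in> edges G. v \<in> e} = {e0}"
    unfolding degree_def by (metis card_1_singletonE)
  then have e0: "e0 \<in> edges G" "v \<in> e0" by auto
  have bound: "1 / sqrt (\<Sum>u\<in>e. real (degree G u))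
      \<le> 9/40 + 11/40 * (\<Sum>u\<in>e. 1 / real (degree G u)) - (if e = e0 then 1/20 else 0)"
    if e: "e \<in> edges G" for e
  proof (cases "e = e0")
    case True
    obtain w where w: "e = {v, w}" "v \<noteq> w"
      using S(4)[OF e] e0(2) True by (metis card_2_iff insert_commute insert_iff singletonD)
    then have "degree G w \<ge> 1" using pos S(3)[OF e] by simp
    from inv_sqrt_bound_pendant[OF this] show ?thesis using w dv True by simp
  next
    case False
    obtain x y where xy: "e = {x, y}" "x \<noteq> y" using S(4)[OF e] by (metis card_2_iff)
    then have "degree G x \<ge> 1" "degree G y \<ge> 1" using pos S(3)[OF e] by auto
    from inv_sqrt_bound[OF this] show ?thesis using xy False by simp
  qed
  have "sum_connectivity G \<le> (\<Sum>e\<in>edges G. 9/40 + 11/40 * (\<Sum>u\<in>e. 1 / real (degree G u))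
      - (if e = e0 then 1/20 else 0))"
    unfolding sum_connectivity_def by (rule sum_mono) (rule bound)
  also have "\<dots> = 9/40 * (real n + 1) + 11/40 * (\<Sum>e\<in>edges G. \<Sum>u\<in>e. 1 / real (degree G u)) - 1/20"
    using e0 S(2) G(4) by (simp add: sum.distrib sum_subtractf sum_distrib_left)
  also have "(\<Sum>e\<in>edges G. \<Sum>u\<in>e. 1 / real (degree G u))
      = (\<Sum>w\<in>verts G. real (degree G w) * (1 / real (degree G w)))"
    by (rule handshake[OF G(1)])
  \<comment> \<open>Positivity of the degrees is essential here: an isolated vertex would contribute
    0 instead of 1, as division by zero yields 0.\<close>
  also have "\<dots> = (\<Sum>w\<in>verts G. 1)"
    by (rule sum.cong) (use pos in force)+
  also have "\<dots> = real n" using G(3) by simp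
  finally show ?thesis by (simp add: field_simps)
qed

section \<open>Bicyclic graphs of minimum degree at least two: degrees and index\<close>

lemma sum_nat_eq_2:
  fixes f :: "'a \<Rightarrow> nat"
  assumes "finite V" "(\<Sum>w\<in>V. f w) = 2"
  shows "(\<exists>u\<in>V. f u = 2 \<and> (\<forall>w\<in>V - {u}. f w = 0)) \<or>
    (\<exists>u\<in>V. \<exists>v\<in>V. u \<noteq> v \<and> f u = 1 \<and> f v = 1 \<and> (\<forall>w\<in>V - {u, v}. f w = 0))"
proof -
  obtain u where u: "u \<in> V" "f u \<noteq> 0"
    using assms by (metis sum.neutral zero_neq_numeral)
  have rem: "f u + (\<Sum>w\<in>V - {u}. f w) = 2" using assms u by (metis sum.remove)
  then consider "f u = 2" "(\<Sum>w\<in>V - {u}. f w) = 0" | "f u = 1" "(\<Sum>w\<in>V - {u}. f w) = 1"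
    using u(2) by linarith
  then show ?thesis
  proof cases
    case 1
    then show ?thesis using assms(1) u by auto
  next
    case 2
    then obtain v where "v \<in> V - {u}" "f v = 1" "\<forall>w\<in>V - {u}. v \<noteq> w \<longrightarrow> f w = 0"
      using assms(1) by (metis (no_types, lifting) finite_Diff sum_eq_1_iff)
    then show ?thesis using 2(1) u(1) by (metis DiffD1 DiffD2 Diff_iff insert_iff singletonI)
  qed
qed

definition two_cubic :: "nat \<Rightarrow> 'a ugraph \<Rightarrow> 'a \<Rightarrow> 'a \<Rightarrow> bool" where
  "two_cubic n G u v \<longleftrightarrow> bicyclic n G \<and> u \<in> verts G \<and> v \<in> verts G \<and> u \<noteq> v \<and>
     degree G u = 3 \<and> degree G v = 3 \<and> (\<forall>w \<in> verts G - {u, v}. degree G w = 2)"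

lemma bicyclic_min_degree_2_cases:
  assumes "bicyclic n G" "\<And>x. x \<in> verts G \<Longrightarrow> degree G x \<ge> 2"
  obtains (one) u where "u \<in> verts G" "degree G u = 4" "\<forall>w \<in> verts G - {u}. degree G w = 2"
  | (two) u v where "two_cubic n G u v"
proof -
  have G: "simple_graph G" "card (verts G) = n" "card (edges G) = n + 1"
    using assms(1) by (auto simp: bicyclic_def)
  note S = simple_graphD[OF G(1)]
  have "real (\<Sum>w\<in>verts G. degree G w) = (\<Sum>e\<in>edges G. \<Sum>w\<in>e. 1)"
    using handshake[OF G(1), of "\<lambda>_. 1"] by simp
  also have "\<dots> = (\<Sum>e\<in>edges G. 2)"
    by (rule sum.cong) (use S(4) in auto)
  finally have "real (\<Sum>w\<in>verts G. degree G w) = real (2 * n + 2)" using G(3) by simp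
  then have "(\<Sum>w\<in>verts G. degree G w) = 2 * n + 2" by linarith
  moreover have "(\<Sum>w\<in>verts G. degree G w) = (\<Sum>w\<in>verts G. degree G w - 2) + 2 * n"
  proof -
    \<comment> \<open>The truncated subtraction is exact because every degree is at least 2.\<close>
    have "(\<Sum>w\<in>verts G. degree G w) = (\<Sum>w\<in>verts G. (degree G w - 2) + 2)"
      by (rule sum.cong) (use assms(2) in force)+
    then show ?thesis using G(2) by (simp only: sum.distrib) simp
  qed
  ultimately have "(\<Sum>w\<in>verts G. degree G w - 2) = 2" by simp
  note sum2 = sum_nat_eq_2[OF S(1) this]
  have eq2: "degree G w = 2" if "w \<in> verts G" "degree G w - 2 = 0" for w
    using assms(2)[OF that(1)] that(2) by simp
  from sum2
  consider u where "u \<in> verts G" "degree G u - 2 = 2" "\<forall>w\<in>verts G - {u}. degree G w - 2 = 0"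
    | u v where "u \<in> verts G" "v \<in> verts G" "u \<noteq> v" "degree G u - 2 = 1" "degree G v - 2 = 1"
      "\<forall>w\<in>verts G - {u, v}. degree G w - 2 = 0" by blast
  then show ?thesis
  proof cases
    case 1
    then have "degree G u = 4" "\<forall>w\<in>verts G - {u}. degree G w = 2"
      using eq2 by simp_all
    with 1 show ?thesis using one by simp
  next
    case 2
    then have "degree G u = 3" "degree G v = 3" "\<forall>w\<in>verts G - {u, v}. degree G w = 2"
      using eq2 by simp_all
    with 2 have "two_cubic n G u v" using assms(1) unfolding two_cubic_def by simp
    then show ?thesis by (rule two)
  qed
qed

lemma sum_of_bool_degree:
  "finite (edges G) \<Longrightarrow> (\<Sum>e\<in>edges G. of_bool (u \<in> e)) = real (degree G u)"
  unfolding degree_def by (simp add: of_bool_def flip: sum.inter_filter)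

text \<open>Four edges have weight 1 / sqrt 6 and the other n - 3 have weight 1/2. Writing the
  weight through the indicator of \<open>u \<in> e\<close> turns the count into the degree of
  \<open>u\<close>.\<close>

lemma sum_connectivity_one_quartic:
  assumes "bicyclic n G" "u \<in> verts G" "degree G u = 4" "\<forall>w \<in> verts G - {u}. degree G w = 2"
  shows "sum_connectivity G = real n / 2 + 4 / sqrt 6 - 3/2"
proof -
  have G: "simple_graph G" "card (edges G) = n + 1"
    using assms(1) by (auto simp: bicyclic_def)
  note S = simple_graphD[OF G(1)]
  have "1 / sqrt (\<Sum>w\<in>e. real (degree G w)) = 1/2 + (1 / sqrt 6 - 1/2) * of_bool (u \<in> e)"
    if e: "e \<in> edges G" for e
  proof -
    obtain x y where xy: "e = {x, y}" "x \<noteq> y" using S(4)[OF e] by (metis card_2_iff)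
    then have "x \<in> verts G" "y \<in> verts G" using S(3)[OF e] by auto
    then have "real (degree G x) = 2 + 2 * of_bool (u = x)" "real (degree G y) = 2 + 2 * of_bool (u = y)"
      using assms(3,4) by auto
    then show ?thesis using xy by (auto simp: of_bool_def)
  qed
  then have "sum_connectivity G = (\<Sum>e\<in>edges G. 1/2 + (1 / sqrt 6 - 1/2) * of_bool (u \<in> e))"
    unfolding sum_connectivity_def by (intro sum.cong) auto
  also have "\<dots> = (real n + 1) / 2 + (1 / sqrt 6 - 1/2) * real (degree G u)"
    using G(2) by (simp only: sum.distrib sum_of_bool_degree[OF S(2)] flip: sum_distrib_left) simp
  finally show ?thesis using assms(3) by (simp add: field_simps)
qed

text \<open>The weight is linear in the two incidence indicators except at a possible edge between
  \<open>u\<close> and \<open>v\<close>. There the linear formula gives 2 / sqrt 5 - 1/2 while the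
  weight is 1 / sqrt 6; the difference is the constant \<open>c\<close>.\<close>

lemma sum_connectivity_two_cubic:
  assumes "two_cubic n G u v"
  shows "sum_connectivity G = (real n - 5) / 2 + 6 / sqrt 5 +
    of_bool ({u, v} \<in> edges G) * (1/2 + 1 / sqrt 6 - 2 / sqrt 5)"
proof -
  have G: "simple_graph G" "card (edges G) = n + 1" "u \<noteq> v"
    using assms(1) by (auto simp: bicyclic_def two_cubic_def)
  note S = simple_graphD[OF G(1)]
  define c where "c = 1/2 + 1 / sqrt 6 - 2 / sqrt 5"
  have "1 / sqrt (\<Sum>w\<in>e. real (degree G w)) =
      1/2 + (1 / sqrt 5 - 1/2) * of_bool (u \<in> e) + (1 / sqrt 5 - 1/2) * of_bool (v \<in> e)
      + c * of_bool (e = {u, v})"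
    if e: "e \<in> edges G" for e
  proof -
    obtain x y where xy: "e = {x, y}" "x \<noteq> y" using S(4)[OF e] by (metis card_2_iff)
    then have "x \<in> verts G" "y \<in> verts G" using S(3)[OF e] by auto
    then have d: "real (degree G x) = 2 + of_bool (u = x) + of_bool (v = x)"
      "real (degree G y) = 2 + of_bool (u = y) + of_bool (v = y)"
      using assms G(3) unfolding two_cubic_def by auto
    have "(\<Sum>w\<in>e. real (degree G w)) = 4 + of_bool (u \<in> e) + of_bool (v \<in> e)"
      using xy d G(3) by auto
    moreover have "e = {u, v} \<longleftrightarrow> u \<in> e \<and> v \<in> e" using xy G(3) by auto
    ultimately show ?thesis by (auto simp: of_bool_def c_def)
  qed
  then have "sum_connectivity G = (\<Sum>e\<in>edges G. 1/2 + (1 / sqrt 5 - 1/2) * of_bool (u \<in> e) +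
      (1 / sqrt 5 - 1/2) * of_bool (v \<in> e) + c * of_bool (e = {u, v}))"
    unfolding sum_connectivity_def by (intro sum.cong) auto
  also have "\<dots> = (real n + 1) / 2 + (1 / sqrt 5 - 1/2) * real (degree G u) +
      (1 / sqrt 5 - 1/2) * real (degree G v) + c * (\<Sum>e\<in>edges G. of_bool (e = {u, v}))"
    using G(2) by (simp only: sum.distrib sum_of_bool_degree[OF S(2)] flip: sum_distrib_left) simp
  also have "(\<Sum>e\<in>edges G. of_bool (e = {u, v})) = (of_bool ({u, v} \<in> edges G) :: real)"
    using S(2) by (simp add: of_bool_def)
  finally have sc: "sum_connectivity G = (real n + 1) / 2 + (1 / sqrt 5 - 1/2) * 3 +
      (1 / sqrt 5 - 1/2) * 3 + c * of_bool ({u, v} \<in> edges G)"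
    using assms unfolding two_cubic_def by simp
  \<comment> \<open>With \<open>r\<close> for 1 / sqrt 5 and \<open>d\<close> for \<open>c\<close>
    this is a polynomial identity; no property of square roots enters.\<close>
  have alg: "S = (m - 5) / 2 + q + b * d"
    if "S = (m + 1) / 2 + (r - 1/2) * 3 + (r - 1/2) * 3 + d * b" "q = 6 * r"
    for S m q r b d :: real
    using that by (simp add: field_simps)
  show ?thesis unfolding c_def[symmetric] by (rule alg[OF sc]) simp
qed

lemma sqrt5_sqrt6_bounds: "223/100 < sqrt 5" "sqrt 5 < 224/100" "244/100 < sqrt 6" "sqrt 6 < 245/100"
  by (rule real_less_rsqrt real_less_lsqrt; simp add: power2_eq_square)+

lemma adjacent_cubic_gain: "1/2 + 1 / sqrt 6 - 2 / sqrt 5 > 0"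
proof -
  have "1 / sqrt 6 > 1 / (245/100)" using sqrt5_sqrt6_bounds by (intro divide_strict_left_mono) auto
  moreover have "2 / sqrt 5 < 2 / (223/100)"
    using sqrt5_sqrt6_bounds by (intro divide_strict_left_mono) auto
  ultimately show ?thesis by simp
qed

text \<open>Leaves only graphs with two cubic vertices to compete for the first two places. The
  tightest comparison is 7/40 = 0.175 against 6 / sqrt 5 - 5/2, about 0.183, for which the bound
  \<open>sqrt 5 < 224/100\<close> is precise enough.\<close>

lemma bicyclic_bound:
  assumes "bicyclic n G" "n \<ge> 2"
  obtains u v where "two_cubic n G u v" | "sum_connectivity G < (real n - 5) / 2 + 6 / sqrt 5"
proof -
  have "6 / sqrt 5 > 6 / (224/100)" using sqrt5_sqrt6_bounds by (intro divide_strict_left_mono) auto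
  then have 5: "real n / 2 + 7/40 < (real n - 5) / 2 + 6 / sqrt 5" by (simp add: field_simps)
  show ?thesis
  proof (cases "\<exists>x \<in> verts G. degree G x \<le> 1")
    case True
    then show ?thesis using sum_connectivity_pendant[OF assms] 5 that by fastforce
  next
    case False
    show ?thesis
    proof (rule bicyclic_min_degree_2_cases[OF assms(1)])
      show "degree G x \<ge> 2" if "x \<in> verts G" for x using False that by force
    next
      fix u assume one: "u \<in> verts G" "degree G u = 4" "\<forall>w \<in> verts G - {u}. degree G w = 2"
      have "4 / sqrt 6 < 4 / (244/100)"
        using sqrt5_sqrt6_bounds by (intro divide_strict_left_mono) auto
      then have "4 / sqrt 6 - 3/2 < 7/40" by simp
      then show ?thesis using sum_connectivity_one_quartic[OF assms(1) one] 5 that by fastforce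
    qed (use that in blast)
  qed
qed

section \<open>Components of two-regular graphs are cycles\<close>

lemma valency_eq_imp_mem:
  assumes "finite E" "F \<subseteq> E" "valency F x = valency E x" "e \<in> E" "x \<in> e"
  shows "e \<in> F"
proof -
  have "{e \<in> F. x \<in> e} = {e \<in> E. x \<in> e}"
    using assms(1-3) by (intro card_subset_eq) auto
  then show ?thesis using assms(4,5) by auto
qed

lemma rtrancl_adj_closed:
  assumes "(x, y) \<in> (adj E)\<^sup>*" "x \<in> K" "\<And>e z. e \<in> E \<Longrightarrow> z \<in> e \<Longrightarrow> z \<in> K \<Longrightarrow> e \<subseteq> K"
  shows "y \<in> K"
  using assms(1,2)
proof (induction rule: rtrancl_induct)
  case (step y z)
  then show ?case using assms(3)[of "{y, z}" y] by auto
qed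

lemma simple_edge_other:
  assumes "simple_graph G" "e \<in> edges G" "x \<in> e"
  obtains y where "e = {x, y}" "x \<noteq> y" "y \<in> verts G"
proof -
  obtain a b where "e = {a, b}" "a \<noteq> b" using simple_graphD(4)[OF assms(1,2)] by (metis card_2_iff)
  moreover have "e \<subseteq> verts G" using simple_graphD(3)[OF assms(1,2)] .
  ultimately show ?thesis using assms(3) that[of a] that[of b] by (auto simp: insert_commute)
qed

lemma two_regular_connected_is_cycle:
  assumes G: "simple_graph G" "connected_graph G" and deg: "\<And>x. x \<in> verts G \<Longrightarrow> degree G x = 2"
  shows "is_cycle (card (verts G)) G"
proof -
  note S = simple_graphD[OF G(1)]
  define P where "P xs \<longleftrightarrow> distinct xs \<and> xs \<noteq> [] \<and> set xs \<subseteq> verts G \<and> path_edges xs \<subseteq> edges G"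
    for xs
  obtain r where r: "r \<in> verts G" using G(2) unfolding connected_graph_def by auto
  have "length xs < Suc (card (verts G))" if "P xs" for xs
    using that card_mono[OF S(1), of "set xs"] unfolding P_def by (simp add: distinct_card)
  moreover have "P [r]" using r by (simp add: P_def)
  ultimately obtain xs where xs: "P xs" and max: "\<And>ys. P ys \<Longrightarrow> length ys \<le> length xs"
    using ex_has_greatest_nat[of P "[r]" length "Suc (card (verts G))"] by blast
  from xs have X: "distinct xs" "xs \<noteq> []" "set xs \<subseteq> verts G" "path_edges xs \<subseteq> edges G"
    unfolding P_def by auto
  have hdV: "hd xs \<in> verts G" using X by auto
  have val: "valency (path_edges xs) z + of_bool (z = hd xs) + of_bool (z = last xs) =
      2 * of_bool (z \<in> set xs)" for z
    using valency_path_edges[OF X(1,2)] .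
  \<comment> \<open>The path accounts for at most one of the two edges at its head.\<close>
  obtain e where e: "e \<in> edges G" "hd xs \<in> e" "e \<notin> path_edges xs"
  proof (rule ccontr)
    assume "\<not> thesis"
    then have "{e \<in> edges G. hd xs \<in> e} \<subseteq> {e \<in> path_edges xs. hd xs \<in> e}" using that by auto
    then have "valency (edges G) (hd xs) \<le> valency (path_edges xs) (hd xs)"
      by (intro card_mono) auto
    moreover have "valency (path_edges xs) (hd xs) \<le> 1" using val[of "hd xs"] by (simp add: of_bool_def split: if_splits)
    ultimately show False using deg[OF hdV] unfolding degree_def by simp
  qed
  obtain y where y: "e = {hd xs, y}" "hd xs \<noteq> y" "y \<in> verts G"
    using simple_edge_other[OF G(1) e(1,2)] .
  have yxs: "y \<in> set xs"
  proof (rule ccontr)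
    assume "y \<notin> set xs"
    moreover obtain z zs where "xs = z # zs" using X(2) by (cases xs) auto
    ultimately have "P (y # xs)" using X y e(1) unfolding P_def by (auto simp: insert_commute)
    then show False using max[of "y # xs"] by simp
  qed
  have "y = last xs"
  proof (rule ccontr)
    assume "y \<noteq> last xs"
    then have "valency (path_edges xs) y = valency (edges G) y"
      using val[of y] yxs y(2) deg[OF y(3)] unfolding degree_def by simp
    from valency_eq_imp_mem[OF S(2) X(4) this e(1)] show False using y(1) e(3) by simp
  qed
  then have e': "e = {last xs, hd xs}" using y by auto
  \<comment> \<open>With one vertex the closing edge would be a loop; with two it would be the path
    edge, but \<open>e\<close> is not on the path.\<close>
  have len: "length xs \<ge> 3"
  proof (rule ccontr)
    assume "\<not> length xs \<ge> 3"
    then consider a where "xs = [a]" | a b where "xs = [a, b]"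
      using X(2) by (cases xs; cases "tl xs"; cases "tl (tl xs)") auto
    then show False using y(2) \<open>y = last xs\<close> e(3) e' by cases (auto simp: insert_commute)
  qed
  have sub: "cycle_edges xs \<subseteq> edges G" using X(4) e(1) e' unfolding cycle_edges_def by auto
  have mem: "f \<in> cycle_edges xs" if "f \<in> edges G" "z \<in> f" "z \<in> set xs" for f z
  proof (rule valency_eq_imp_mem[OF S(2) sub _ that(1,2)])
    show "valency (cycle_edges xs) z = valency (edges G) z"
      using valency_cycle_edges[OF X(1) len, of z] that(3) X(3) deg[of z] unfolding degree_def by auto
  qed
  have "x \<in> set xs" if "x \<in> verts G" for x
  proof (rule rtrancl_adj_closed)
    show "(hd xs, x) \<in> (adj (edges G))\<^sup>*" using G(2) connected_graph_iff[OF hdV] that by simp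
    show "f \<subseteq> set xs" if "f \<in> edges G" "z \<in> f" "z \<in> set xs" for f z
      using cycle_edges_subset[OF X(2) mem[OF that]] .
  qed (use X(2) in simp)
  then have V: "verts G = set xs" using X(3) by auto
  have "edges G \<subseteq> cycle_edges xs"
  proof
    fix f assume f: "f \<in> edges G"
    then obtain a where "a \<in> f" using S(4)[OF f] by fastforce
    then show "f \<in> cycle_edges xs" using mem[OF f] S(3)[OF f] V by auto
  qed
  then have "G = UGraph (set xs) (cycle_edges xs)" using sub V by (cases G) auto
  then show ?thesis unfolding is_cycle_iff using X(1) len V by (auto simp: distinct_card)
qed

definition component :: "'a ugraph \<Rightarrow> 'a \<Rightarrow> 'a ugraph" where
  "component G r = UGraph {x. (r, x) \<in> (adj (edges G))\<^sup>*}
     {e \<in> edges G. e \<subseteq> {x. (r, x) \<in> (adj (edges G))\<^sup>*}}"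

lemma component_edge_closed:
  assumes "simple_graph G" "e \<in> edges G" "x \<in> e" "x \<in> verts (component G r)"
  shows "e \<in> edges (component G r)"
proof -
  obtain y where y: "e = {x, y}" using simple_edge_other[OF assms(1-3)] by metis
  then have "(x, y) \<in> adj (edges G)" using assms(2) by simp
  moreover have rx: "(r, x) \<in> (adj (edges G))\<^sup>*" using assms(4) by (simp add: component_def)
  ultimately have "(r, y) \<in> (adj (edges G))\<^sup>*" by (meson rtrancl_into_rtrancl)
  with rx show ?thesis using assms y unfolding component_def by simp
qed

lemma component_subset:
  assumes "simple_graph G" "r \<in> verts G"
  shows "verts (component G r) \<subseteq> verts G"
proof
  fix x assume "x \<in> verts (component G r)"
  then have "(r, x) \<in> (adj (edges G))\<^sup>*" unfolding component_def by simp
  then show "x \<in> verts G"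
    by (rule rtrancl_adj_closed) (use assms simple_graphD(3) in blast)+
qed

lemma component_is_cycle:
  assumes G: "simple_graph G" and deg: "\<And>x. x \<in> verts G \<Longrightarrow> degree G x = 2" and r: "r \<in> verts G"
  shows "is_cycle (card (verts (component G r))) (component G r)"
proof (rule two_regular_connected_is_cycle)
  let ?C = "component G r"
  have edges_sub: "edges ?C \<subseteq> edges G" unfolding component_def by auto
  have verts_sub: "verts ?C \<subseteq> verts G" by (rule component_subset[OF G r])
  show "simple_graph ?C"
    using G verts_sub finite_subset unfolding simple_graph_def component_def by auto
  have rC: "r \<in> verts ?C" unfolding component_def by simp
  have "(r, x) \<in> (adj (edges ?C))\<^sup>*" if "(r, x) \<in> (adj (edges G))\<^sup>*" for x
    using that
  proof (induction rule: rtrancl_induct)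
    case (step y z)
    then have "{y, z} \<in> edges ?C"
      using component_edge_closed[OF G, of "{y, z}" y r] unfolding component_def by auto
    then have "(y, z) \<in> adj (edges ?C)" by simp
    with step(3) show ?case by (rule rtrancl_into_rtrancl)
  qed simp
  then have "\<forall>x \<in> verts ?C. (r, x) \<in> (adj (edges ?C))\<^sup>*"
    by (simp add: component_def)
  then show "connected_graph ?C" using connected_graph_iff[OF rC] by simp
  show "degree ?C x = 2" if x: "x \<in> verts ?C" for x
  proof -
    have "{e \<in> edges ?C. x \<in> e} = {e \<in> edges G. x \<in> e}"
      using edges_sub component_edge_closed[OF G _ _ x] by auto
    then show ?thesis using deg[of x] verts_sub x unfolding degree_def by auto
  qed
qed

section \<open>Decomposition along a path between the cubic vertices\<close>

lemma rtrancl_adj_obtain_path: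
  assumes "(x, y) \<in> (adj E)\<^sup>*"
  obtains xs where "distinct xs" "xs \<noteq> []" "hd xs = x" "last xs = y" "path_edges xs \<subseteq> E"
proof -
  have "\<exists>xs. distinct xs \<and> xs \<noteq> [] \<and> hd xs = x \<and> last xs = y \<and> path_edges xs \<subseteq> E"
    using assms
  proof (induction rule: converse_rtrancl_induct)
    case base
    then show ?case by (intro exI[of _ "[y]"]) simp
  next
    case (step x z)
    then obtain xs where xs: "distinct xs" "xs \<noteq> []" "hd xs = z" "last xs = y" "path_edges xs \<subseteq> E"
      by auto
    show ?case
    proof (cases "x \<in> set xs")
      \<comment> \<open>The new vertex already lies on the path: the detour is cut off by keeping
        the suffix that starts there.\<close>
      case True
      then obtain as bs where ab: "xs = as @ x # bs" by (metis split_list)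
      have "path_edges (x # bs) \<subseteq> path_edges xs"
        using path_edges_append[of as "x # bs"] ab by (cases "as = []") auto
      then show ?thesis using xs ab by (intro exI[of _ "x # bs"]) auto
    next
      case False
      obtain w ws where "xs = w # ws" using xs(2) by (cases xs) auto
      then show ?thesis using xs False step(1) by (intro exI[of _ "x # xs"]) auto
    qed
  qed
  then show ?thesis using that by auto
qed

text \<open>The path adds l - 1 new vertices to the a vertices of the cycle, hence
  \<open>a + l = n + 1\<close>, a form free of subtraction. A chord is the case l = 1.\<close>

definition theta_graphs :: "nat \<Rightarrow> nat \<Rightarrow> 'a ugraph set" where
  "theta_graphs l n = {G. \<exists>a C P u v. is_cycle a C \<and> u \<in> verts C \<and> v \<in> verts C \<and> u \<noteq> v \<and>
     {u, v} \<notin> edges C \<and> is_path l u v P \<and> verts P \<inter> verts C = {u, v} \<and> a + l = n + 1 \<and>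
     G = graph_union C P}"

definition dumbbell_graphs :: "nat \<Rightarrow> nat \<Rightarrow> 'a ugraph set" where
  "dumbbell_graphs l n = {G. \<exists>a b C D P u v. is_cycle a C \<and> is_cycle b D \<and>
     verts C \<inter> verts D = {} \<and> is_path l u v P \<and> verts P \<inter> verts C = {u} \<and>
     verts P \<inter> verts D = {v} \<and> a + b + l = n + 1 \<and>
     G = graph_union (graph_union C D) P}"

text \<open>The path takes one edge at \<open>u\<close>, one at \<open>v\<close> and both edges at
  each interior vertex, so the remainder \<open>H\<close> is 2-regular. Its components at
  \<open>u\<close> and \<open>v\<close> cover it: if they coincide, \<open>H\<close> is one cycle
  and \<open>G\<close> is a theta graph; if not, \<open>G\<close> is a dumbbell.\<close>

lemma two_cubic_decompose:
  assumes tc: "two_cubic n G u v"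
    and xs: "distinct xs" "hd xs = u" "last xs = v" "path_edges xs \<subseteq> edges G"
    and len: "length xs = Suc l" "l \<ge> 1"
    and adj: "{u, v} \<in> edges G \<Longrightarrow> l = 1"
  shows "G \<in> theta_graphs l n \<union> dumbbell_graphs l n"
proof -
  have G: "simple_graph G" "connected_graph G" "card (verts G) = n"
    and uv: "u \<in> verts G" "v \<in> verts G" "u \<noteq> v" "degree G u = 3" "degree G v = 3"
    and deg2: "\<And>w. w \<in> verts G \<Longrightarrow> w \<noteq> u \<Longrightarrow> w \<noteq> v \<Longrightarrow> degree G w = 2"
    using tc unfolding two_cubic_def bicyclic_def by auto
  note S = simple_graphD[OF G(1)]
  have xne: "xs \<noteq> []" using len by auto
  have uvx: "u \<in> set xs" "v \<in> set xs" using xs xne by auto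
  have reach: "(u, x) \<in> (adj (path_edges xs))\<^sup>*" if "x \<in> set xs" for x
    using path_edges_reach_hd[OF that] xs(2) by simp
  have xV: "set xs \<subseteq> verts G"
  proof
    fix x assume "x \<in> set xs"
    from reach[OF this] show "x \<in> verts G"
      by (rule rtrancl_adj_closed) (use uv(1) xs(4) S(3) in blast)+
  qed
  define H where "H = UGraph (verts G - (set xs - {u, v})) (edges G - path_edges xs)"
  define P where "P = UGraph (set xs) (path_edges xs)"
  have isP: "is_path l u v P" unfolding is_path_iff P_def using xs len by auto
  have PH: "verts P \<inter> verts H = {u, v}" using uvx xV by (auto simp: P_def H_def)
  have GHP: "G = graph_union H P"
    using xV xs(4) by (cases G) (auto simp: graph_union_def H_def P_def)
  have val: "valency (path_edges xs) z + of_bool (z = u) + of_bool (z = v) = 2 * of_bool (z \<in> set xs)"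
    for z using valency_path_edges[OF xs(1) xne, of z] xs(2,3) by simp
  have degH: "degree G z = degree H z + valency (path_edges xs) z" for z
  proof -
    have "edges G = edges H \<union> path_edges xs" using xs(4) by (auto simp: H_def)
    then show ?thesis unfolding degree_def
      using valency_Un[of "edges H" "path_edges xs" z] S(2) by (auto simp: H_def)
  qed
  have finH: "finite (edges H)" using S(2) by (simp add: H_def)
  \<comment> \<open>Both edges of \<open>G\<close> at an interior vertex of the path lie on the
    path, so none is left in \<open>H\<close>.\<close>
  have interior: "e \<notin> edges H" if z: "z \<in> set xs" "z \<noteq> u" "z \<noteq> v" "z \<in> e" for e z
  proof
    assume "e \<in> edges H"
    then have "{e \<in> edges H. z \<in> e} \<noteq> {}" using z(4) by blast
    then have "degree H z > 0" unfolding degree_def using finH by (simp add: card_gt_0_iff)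
    then show False using degH[of z] val[of z] z deg2[of z] xV by auto
  qed
  have simpleH: "simple_graph H"
    unfolding simple_graph_def
  proof (intro conjI ballI)
    show "finite (verts H)" using S(1) by (simp add: H_def)
    fix e assume e: "e \<in> edges H"
    then show "card e = 2" using S(4) by (simp add: H_def)
    show "e \<subseteq> verts H" using e S(3)[of e] interior[of _ e] by (auto simp: H_def)
  qed
  have regH: "degree H x = 2" if "x \<in> verts H" for x
    using degH[of x] val[of x] deg2[of x] uv uvx that
    by (cases "x = u"; cases "x = v") (auto simp: H_def)
  have cardH: "card (verts H) + l = n + 1"
  proof -
    have "card (set xs - {u, v}) = card (set xs) - card {u, v}"
      using uvx by (intro card_Diff_subset) auto
    then have "card (set xs - {u, v}) = l - 1" using xs(1) len uv(3) by (simp add: distinct_card)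
    moreover have "card (verts H) = card (verts G) - card (set xs - {u, v})"
      unfolding H_def ugraph.sel using xV by (intro card_Diff_subset) auto
    moreover have "card (set xs) \<le> n" using card_mono[OF S(1) xV] G(3) by simp
    ultimately show ?thesis using len G(3) xs(1) by (simp add: distinct_card)
  qed
  \<comment> \<open>By \<open>adj\<close>, an edge between \<open>u\<close> and \<open>v\<close>
    forces l = 1; then it is the path itself and has been deleted.\<close>
  have uvH: "{u, v} \<notin> edges H"
  proof
    assume a: "{u, v} \<in> edges H"
    then have "l = 1" using adj by (simp add: H_def)
    then obtain x y where "xs = [x, y]" using len by (cases xs; cases "tl xs") auto
    then show False using a xs(2,3) by (simp add: H_def)
  qed
  have uvH': "u \<in> verts H" "v \<in> verts H" using uv by (auto simp: H_def)
  define K where "K = component H u"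
  define L where "L = component H v"
  have cyc: "is_cycle (card (verts K)) K" "is_cycle (card (verts L)) L"
    unfolding K_def L_def using component_is_cycle[OF simpleH regH] uvH' by auto
  have self: "u \<in> verts K" "v \<in> verts L" unfolding K_def L_def component_def by auto
  have subH: "verts K \<subseteq> verts H" "verts L \<subseteq> verts H"
    unfolding K_def L_def using component_subset[OF simpleH] uvH' by auto
  have cover: "x \<in> verts K \<or> x \<in> verts L" if x: "x \<in> verts H" for x
  proof -
    have "x \<in> verts G" using x by (simp add: H_def)
    then have "(x, u) \<in> (adj (edges G))\<^sup>*"
      using G(2) connected_graph_iff[OF uv(1)] adj_rtrancl_sym[of u x] by auto
    \<comment> \<open>Follow a walk in \<open>G\<close> from \<open>x\<close> to \<open>u\<close>.
      Where it first uses a deleted edge it stands at a path vertex that survives in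
      \<open>H\<close>, that is, at \<open>u\<close> or \<open>v\<close>. The implication is needed
      because the rest of the walk may visit deleted vertices.\<close>
    then have "x \<in> verts H \<longrightarrow> (x, u) \<in> (adj (edges H))\<^sup>* \<or> (x, v) \<in> (adj (edges H))\<^sup>*"
    proof (induction rule: converse_rtrancl_induct)
      case (step x y)
      show ?case
      proof
        assume xH: "x \<in> verts H"
        show "(x, u) \<in> (adj (edges H))\<^sup>* \<or> (x, v) \<in> (adj (edges H))\<^sup>*"
        proof (cases "{x, y} \<in> path_edges xs")
          case True
          then have "x \<in> set xs" using path_edges_subset by fastforce
          then have "x = u \<or> x = v" using xH by (auto simp: H_def)
          then show ?thesis by auto
        next
          case False
          then have xy: "{x, y} \<in> edges H" using step(1) by (simp add: H_def)
          then have "y \<in> verts H" using simple_graphD(3)[OF simpleH xy] by simp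
          moreover have "(x, y) \<in> adj (edges H)" using xy by simp
          ultimately show ?thesis using step(3) by (meson converse_rtrancl_into_rtrancl)
        qed
      qed
    qed simp
    then show ?thesis using x adj_rtrancl_sym[of x _ "edges H"] unfolding K_def L_def component_def
      by auto
  qed
  have edgesKL: "e \<in> edges K \<union> edges L" if e: "e \<in> edges H" for e
  proof -
    obtain x where "x \<in> e" using simple_graphD(4)[OF simpleH e] by fastforce
    then have "x \<in> verts H" using simple_graphD(3)[OF simpleH e] by auto
    from cover[OF this] show ?thesis unfolding K_def L_def
      using component_edge_closed[OF simpleH e \<open>x \<in> e\<close>] by auto
  qed
  have esub: "edges K \<subseteq> edges H" "edges L \<subseteq> edges H" unfolding K_def L_def component_def by auto
  show ?thesis
  proof (cases "v \<in> verts K")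
    case True
    then have uvr: "(u, v) \<in> (adj (edges H))\<^sup>*" unfolding K_def component_def by simp
    have "verts L \<subseteq> verts K" unfolding K_def L_def component_def using rtrancl_trans[OF uvr] by auto
    then have V: "verts K = verts H" using cover subH by auto
    have "edges K = {e \<in> edges H. e \<subseteq> verts K}" by (simp add: K_def component_def)
    then have "edges K = edges H" using V simple_graphD(3)[OF simpleH] by auto
    with V have "K = H" by (cases K; cases H) auto
    then have "is_cycle (card (verts H)) H" using cyc by simp
    then have "G \<in> theta_graphs l n"
      unfolding theta_graphs_def using uvH uvH' uv(3) isP PH cardH GHP by blast
    then show ?thesis ..
  next
    case False
    have disj: "verts K \<inter> verts L = {}"
    proof (rule ccontr)
      assume "verts K \<inter> verts L \<noteq> {}"
      then obtain w where "(u, w) \<in> (adj (edges H))\<^sup>*" "(v, w) \<in> (adj (edges H))\<^sup>*"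
        unfolding K_def L_def component_def by auto
      then have "(u, v) \<in> (adj (edges H))\<^sup>*" using adj_rtrancl_sym rtrancl_trans by metis
      then show False using False unfolding K_def component_def by simp
    qed
    have V: "verts H = verts K \<union> verts L" using cover subH by auto
    have "edges H = edges K \<union> edges L" using edgesKL esub by auto
    with V have "H = graph_union K L" by (cases H) (simp add: graph_union_def)
    then have GKL: "G = graph_union (graph_union K L) P" using GHP by simp
    have "verts P \<inter> verts K = {u}" "verts P \<inter> verts L = {v}" using PH V disj self by auto
    moreover have "card (verts K) + card (verts L) + l = n + 1"
    proof -
      have "finite (verts H)" using simpleH by (simp add: simple_graph_def)
      then have "card (verts H) = card (verts K) + card (verts L)"
        unfolding V using disj by (intro card_Un_disjoint) auto
      then show ?thesis using cardH by simp
    qed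
    ultimately have "G \<in> dumbbell_graphs l n"
      unfolding dumbbell_graphs_def using cyc disj isP GKL by blast
    then show ?thesis ..
  qed
qed

text \<open>Adjacent cubic vertices dictate the one-edge path. Otherwise any path between them
  serves, and it has at least three vertices.\<close>

lemma two_cubic_imp_family:
  assumes tc: "two_cubic n G u v"
  shows "\<exists>l. (if {u, v} \<in> edges G then l = 1 else l \<ge> 2) \<and> G \<in> theta_graphs l n \<union> dumbbell_graphs l n"
proof (cases "{u, v} \<in> edges G")
  case True
  then have "G \<in> theta_graphs 1 n \<union> dumbbell_graphs 1 n"
    using two_cubic_decompose[OF tc, of "[u, v]" 1] tc by (simp add: two_cubic_def)
  then show ?thesis using True by auto
next
  case False
  have uv: "u \<in> verts G" "v \<in> verts G" "u \<noteq> v" and con: "connected_graph G"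
    using tc unfolding two_cubic_def bicyclic_def by auto
  have "(u, v) \<in> (adj (edges G))\<^sup>*" using con connected_graph_iff[OF uv(1)] uv(2) by auto
  then obtain xs where xs: "distinct xs" "xs \<noteq> []" "hd xs = u" "last xs = v" "path_edges xs \<subseteq> edges G"
    by (rule rtrancl_adj_obtain_path)
  have len: "length xs \<ge> 3"
  proof (rule ccontr)
    assume "\<not> length xs \<ge> 3"
    then consider a where "xs = [a]" | a b where "xs = [a, b]"
      using xs(2) by (cases xs; cases "tl xs"; cases "tl (tl xs)") auto
    then show False using uv(3) False xs by cases auto
  qed
  then have "G \<in> theta_graphs (length xs - 1) n \<union> dumbbell_graphs (length xs - 1) n"
    using two_cubic_decompose[OF tc xs(1,3,4,5), of "length xs - 1"] False by auto
  then show ?thesis using len False by (intro exI[of _ "length xs - 1"]) auto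
qed

section \<open>The converse: attaching a path to a two-regular graph\<close>

lemma is_cycleD:
  assumes "is_cycle k C"
  shows "simple_graph C" "connected_graph C" "card (verts C) = k" "card (edges C) = k"
    "degree C x = 2 * of_bool (x \<in> verts C)" "k \<ge> 3"
proof -
  obtain xs where xs: "distinct xs" "length xs = k" "C = UGraph (set xs) (cycle_edges xs)" "k \<ge> 3"
    using assms unfolding is_cycle_iff by auto
  then have ne: "xs \<noteq> []" and len: "length xs \<ge> 3" by auto
  show "simple_graph C" unfolding simple_graph_def
    using xs(3) cycle_edges_subset[OF ne] cycle_edges_card2[OF xs(1) len] by simp
  show "connected_graph C" using connected_cycle[OF ne] xs(3) by simp
  show "card (verts C) = k" "card (edges C) = k" "k \<ge> 3"
    using xs len by (simp_all add: distinct_card card_cycle_edges)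
  show "degree C x = 2 * of_bool (x \<in> verts C)"
    using valency_cycle_edges[OF xs(1) len, of x] xs(3) by (simp add: degree_def)
qed

lemma attach_path_two_cubic:
  assumes H: "simple_graph H" "\<And>x. degree H x = 2 * of_bool (x \<in> verts H)"
      "card (edges H) = card (verts H)"
    and P: "is_path l u v P" "u \<noteq> v" "verts P \<inter> verts H = {u, v}" "{u, v} \<notin> edges H"
    and con: "connected_graph (graph_union H P)"
    and n: "card (verts H) + l = n + 1"
  shows "two_cubic n (graph_union H P) u v" "{u, v} \<in> edges (graph_union H P) \<longleftrightarrow> l = 1"
proof -
  let ?G = "graph_union H P"
  note S = simple_graphD[OF H(1)]
  obtain xs where xs: "distinct xs" "length xs = Suc l" "hd xs = u" "last xs = v"
    "P = UGraph (set xs) (path_edges xs)" using P(1) unfolding is_path_iff by auto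
  have xne: "xs \<noteq> []" using xs(2) by auto
  have uvx: "u \<in> set xs" "v \<in> set xs" using xs xne by auto
  have uvH: "u \<in> verts H" "v \<in> verts H" using P(3) by auto
  \<comment> \<open>A common edge would lie inside the intersection of the vertex sets, hence be
    \<open>{u, v}\<close>, which is not an edge of \<open>H\<close>.\<close>
  have disj: "edges H \<inter> path_edges xs = {}"
  proof (rule ccontr)
    assume "edges H \<inter> path_edges xs \<noteq> {}"
    then obtain e where e: "e \<in> edges H" "e \<in> path_edges xs" by auto
    then have "e \<subseteq> {u, v}" using S(3)[OF e(1)] path_edges_subset[OF e(2)] P(3) xs(5) by auto
    moreover have "card e = card {u, v}" using S(4)[OF e(1)] P(2) by simp
    ultimately have "e = {u, v}" by (intro card_subset_eq) auto
    then show False using e(1) P(4) by simp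
  qed
  have l: "l \<ge> 1"
  proof (rule ccontr)
    assume "\<not> l \<ge> 1"
    then obtain a where "xs = [a]" using xs(2) by (cases xs; cases "tl xs") auto
    then show False using xs(3,4) P(2) by simp
  qed
  have deg: "degree ?G z + of_bool (z = u) + of_bool (z = v) =
      2 * of_bool (z \<in> verts H) + 2 * of_bool (z \<in> set xs)" for z
    using valency_Un[OF S(2) finite_path_edges disj, of z] H(2)[of z]
      valency_path_edges[OF xs(1) xne, of z] xs(3-5)
    unfolding degree_def graph_union_def by simp
  have vG: "verts ?G = verts H \<union> set xs" using xs(5) by (simp add: graph_union_def)
  have inter: "verts H \<inter> set xs = {u, v}" using P(3) xs(5) by auto
  have cardV: "card (verts ?G) = n"
  proof -
    have "card (verts ?G) + card {u, v} = card (verts H) + card (set xs)"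
      unfolding vG inter[symmetric] using S(1) by (subst card_Un_Int[symmetric]) auto
    then show ?thesis using P(2) n xs(1,2) by (simp add: distinct_card)
  qed
  have "card (edges ?G) = card (edges H) + card (path_edges xs)"
    using xs(5) S(2) disj by (simp add: graph_union_def card_Un_disjoint)
  then have cardE: "card (edges ?G) = n + 1" using H(3) n card_path_edges[OF xs(1)] xs(2) by simp
  have "simple_graph ?G"
    using H(1) xs(5) path_edges_subset path_edges_card2[OF xs(1)]
    unfolding simple_graph_def graph_union_def by auto
  then have bic: "bicyclic n ?G" unfolding bicyclic_def using con cardV cardE by simp
  have "degree ?G u = 3" "degree ?G v = 3" using deg[of u] deg[of v] P(2) uvx uvH by auto
  moreover have "degree ?G w = 2" if "w \<in> verts ?G - {u, v}" for w
    using deg[of w] that inter vG by auto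
  ultimately show "two_cubic n ?G u v"
    unfolding two_cubic_def using bic uvH P(2) by (simp add: graph_union_def)
  have "{u, v} \<in> edges ?G \<longleftrightarrow> {u, v} \<in> path_edges xs" using P(4) xs(5) by (simp add: graph_union_def)
  also have "\<dots> \<longleftrightarrow> l = 1"
  proof (cases "l = 1")
    case True
    then obtain a b where "xs = [a, b]" using xs(2) by (cases xs; cases "tl xs") auto
    then show ?thesis using xs(3,4) True by simp
  next
    \<comment> \<open>For l >= 2 the pair \<open>{u, v}\<close> is the closing pair of the path,
      which is not one of its edges.\<close>
    case False
    then show ?thesis using last_edge_notin[OF xs(1)] xs(2,3,4) l by (simp add: insert_commute)
  qed
  finally show "{u, v} \<in> edges ?G \<longleftrightarrow> l = 1" .
qed

lemma is_path_connected:
  assumes "is_path l u v P"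
  shows "connected_graph P" "u \<in> verts P" "v \<in> verts P"
proof -
  obtain xs where xs: "length xs = Suc l" "hd xs = u" "last xs = v" "P = UGraph (set xs) (path_edges xs)"
    using assms unfolding is_path_iff by auto
  then have "xs \<noteq> []" by auto
  with xs show "connected_graph P" "u \<in> verts P" "v \<in> verts P" using connected_path[of xs] by auto
qed

lemma theta_graphs_two_cubic:
  assumes "G \<in> theta_graphs l n"
  shows "\<exists>u v. two_cubic n G u v \<and> ({u, v} \<in> edges G \<longleftrightarrow> l = 1)"
proof -
  obtain a C P u v where C: "is_cycle a C" and uv: "u \<in> verts C" "v \<in> verts C" "u \<noteq> v"
     "{u, v} \<notin> edges C" and P: "is_path l u v P" "verts P \<inter> verts C = {u, v}" and n: "a + l = n + 1"
     and G: "G = graph_union C P" using assms unfolding theta_graphs_def by auto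
  note c = is_cycleD[OF C]
  have "connected_graph (graph_union C P)"
    by (rule connected_union[OF c(2) is_path_connected(1)[OF P(1)] uv(1) is_path_connected(2)[OF P(1)]])
  from attach_path_two_cubic[OF c(1,5) _ P(1) uv(3) P(2) uv(4) this] c(3,4) n G show ?thesis by auto
qed

lemma dumbbell_graphs_two_cubic:
  assumes "G \<in> dumbbell_graphs l n"
  shows "\<exists>u v. two_cubic n G u v \<and> ({u, v} \<in> edges G \<longleftrightarrow> l = 1)"
proof -
  obtain a b C D P u v where C: "is_cycle a C" and D: "is_cycle b D"
    and disj: "verts C \<inter> verts D = {}"
    and P: "is_path l u v P" "verts P \<inter> verts C = {u}" "verts P \<inter> verts D = {v}"
    and n: "a + b + l = n + 1" and G: "G = graph_union (graph_union C D) P"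
    using assms unfolding dumbbell_graphs_def by auto
  note c = is_cycleD[OF C] and d = is_cycleD[OF D]
  note Sc = simple_graphD[OF c(1)] and Sd = simple_graphD[OF d(1)]
  let ?H = "graph_union C D"
  have edisj: "edges C \<inter> edges D = {}"
  proof (rule ccontr)
    assume "edges C \<inter> edges D \<noteq> {}"
    then obtain e where e: "e \<in> edges C" "e \<in> edges D" by auto
    then have "e \<subseteq> {}" using Sc(3)[OF e(1)] Sd(3)[OF e(2)] disj by auto
    then show False using Sc(4)[OF e(1)] by simp
  qed
  have uv: "u \<in> verts C" "v \<in> verts D" "u \<noteq> v" using P disj by auto
  have 1: "simple_graph ?H" using c(1) d(1) unfolding simple_graph_def graph_union_def by auto
  have 2: "degree ?H x = 2 * of_bool (x \<in> verts ?H)" for x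
    using valency_Un[OF Sc(2) Sd(2) edisj, of x] c(5)[of x] d(5)[of x] disj
    unfolding degree_def graph_union_def by auto
  have cv: "card (verts ?H) = a + b"
    using c(3) d(3) disj Sc(1) Sd(1) by (simp add: graph_union_def card_Un_disjoint)
  have ce: "card (edges ?H) = a + b"
    using c(4) d(4) edisj Sc(2) Sd(2) by (simp add: graph_union_def card_Un_disjoint)
  have 3: "verts P \<inter> verts ?H = {u, v}" using P by (auto simp: graph_union_def)
  have 4: "{u, v} \<notin> edges ?H"
    using Sc(3)[of "{u, v}"] Sd(3)[of "{u, v}"] uv disj by (auto simp: graph_union_def)
  \<comment> \<open>The two cycles share no vertex, so the path is glued to \<open>C\<close> at
    \<open>u\<close> first, and \<open>D\<close> is added at \<open>v\<close> afterwards.\<close>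
  have "connected_graph (graph_union C P)"
    by (rule connected_union[OF c(2) is_path_connected(1)[OF P(1)] uv(1) is_path_connected(2)[OF P(1)]])
  moreover have "v \<in> verts (graph_union C P)"
    using is_path_connected(3)[OF P(1)] by (simp add: graph_union_def)
  ultimately have "connected_graph (graph_union (graph_union C P) D)"
    using connected_union[OF _ d(2) _ uv(2)] by simp
  moreover have "graph_union (graph_union C P) D = graph_union ?H P"
    by (auto simp: graph_union_def)
  ultimately have "connected_graph (graph_union ?H P)" by simp
  from attach_path_two_cubic[OF 1 2 _ P(1) uv(3) 3 4 this] cv ce n G show ?thesis by auto
qed

section \<open>The four families as theta and dumbbell graphs\<close>

lemma is_path_1: "is_path 1 u v P \<longleftrightarrow> u \<noteq> v \<and> P = UGraph {u, v} {{u, v}}"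
proof
  assume "is_path 1 u v P"
  then obtain xs where xs: "distinct xs" "length xs = 2" "hd xs = u" "last xs = v"
    "P = UGraph (set xs) (path_edges xs)" unfolding is_path_iff by auto
  then obtain a b where "xs = [a, b]" by (cases xs; cases "tl xs") auto
  then show "u \<noteq> v \<and> P = UGraph {u, v} {{u, v}}" using xs by auto
next
  assume "u \<noteq> v \<and> P = UGraph {u, v} {{u, v}}"
  then show "is_path 1 u v P" unfolding is_path_iff by (intro exI[of _ "[u, v]"]) auto
qed

lemma add_edge_eq_union:
  "u \<in> verts G \<Longrightarrow> v \<in> verts G \<Longrightarrow> add_edge G u v = graph_union G (UGraph {u, v} {{u, v}})"
  by (auto simp: add_edge_def graph_union_def)

lemma theta_graphsI:
  assumes "is_cycle a C" "u \<in> verts C" "v \<in> verts C" "u \<noteq> v" "{u, v} \<notin> edges C" "is_path l u v P"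
    "verts P \<inter> verts C = {u, v}" "a + l = n + 1"
  shows "graph_union C P \<in> theta_graphs l n"
  unfolding theta_graphs_def using assms by blast

lemma B3_1_eq: "B3_1 n = theta_graphs 1 n"
proof (intro equalityI subsetI)
  fix G :: "'a ugraph" assume "G \<in> B3_1 n"
  then obtain C u v where *: "is_cycle n C" "u \<in> verts C" "v \<in> verts C" "u \<noteq> v" "{u, v} \<notin> edges C"
    "G = add_edge C u v" unfolding B3_1_def by auto
  then show "G \<in> theta_graphs 1 n" unfolding theta_graphs_def is_path_1
    by (intro CollectI exI[of _ n] exI[of _ C] exI[of _ "UGraph {u, v} {{u, v}}"] exI[of _ u] exI[of _ v])
      (auto simp: add_edge_eq_union)
next
  fix G :: "'a ugraph" assume "G \<in> theta_graphs 1 n"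
  then obtain a C P u v where *: "is_cycle a C" "u \<in> verts C" "v \<in> verts C" "u \<noteq> v" "{u, v} \<notin> edges C"
    "P = UGraph {u, v} {{u, v}}" "a = n" "G = graph_union C P"
    unfolding theta_graphs_def is_path_1 by auto
  then have "G = add_edge C u v" using add_edge_eq_union by metis
  then show "G \<in> B3_1 n" unfolding B3_1_def using * by auto
qed

lemma B1_1_eq: "B1_1 n = dumbbell_graphs 1 n"
proof (intro equalityI subsetI)
  fix G :: "'a ugraph" assume "G \<in> B1_1 n"
  then obtain a b C D u v where *: "is_cycle a C" "is_cycle b D" "a + b = n" "verts C \<inter> verts D = {}"
    "u \<in> verts C" "v \<in> verts D" "G = add_edge (graph_union C D) u v" unfolding B1_1_def by auto
  have "G = graph_union (graph_union C D) (UGraph {u, v} {{u, v}})"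
    unfolding *(7) by (rule add_edge_eq_union) (use * in \<open>auto simp: graph_union_def\<close>)
  then show "G \<in> dumbbell_graphs 1 n" unfolding dumbbell_graphs_def is_path_1 using *
    by (intro CollectI exI[of _ a] exI[of _ b] exI[of _ C] exI[of _ D]
      exI[of _ "UGraph {u, v} {{u, v}}"] exI[of _ u] exI[of _ v]) auto
next
  fix G :: "'a ugraph" assume "G \<in> dumbbell_graphs 1 n"
  then obtain a b C D P u v where *: "is_cycle a C" "is_cycle b D" "a + b = n" "verts C \<inter> verts D = {}"
    "P = UGraph {u, v} {{u, v}}" "verts P \<inter> verts C = {u}" "verts P \<inter> verts D = {v}"
    "G = graph_union (graph_union C D) P"
    unfolding dumbbell_graphs_def is_path_1 by auto
  then have uv: "u \<in> verts C" "v \<in> verts D" by auto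
  then have "G = add_edge (graph_union C D) u v"
    using add_edge_eq_union[of u "graph_union C D" v] *(5,8) by (simp add: graph_union_def)
  then show "G \<in> B1_1 n" unfolding B1_1_def using *(1-4) uv by blast
qed

lemma B1_2_eq: "B1_2 n = (\<Union>l\<in>{2..}. dumbbell_graphs l n)"
proof (intro equalityI subsetI)
  fix G :: "'a ugraph" assume "G \<in> B1_2 n"
  then obtain a b C D P u v where *: "is_cycle a C" "is_cycle b D" "a + b < n" "verts C \<inter> verts D = {}"
    "is_path (n - a - b + 1) u v P" "verts P \<inter> verts C = {u}" "verts P \<inter> verts D = {v}"
    "G = graph_union (graph_union C D) P" unfolding B1_2_def by auto
  \<comment> \<open>The strict inequality \<open>a + b < n\<close> makes the truncated subtraction
    exact and the path length at least 2.\<close>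
  have "a + b + (n - a - b + 1) = n + 1" using *(3) by simp
  then have "G \<in> dumbbell_graphs (n - a - b + 1) n" unfolding dumbbell_graphs_def using * by blast
  moreover have "n - a - b + 1 \<in> {2..}" using *(3) by simp
  ultimately show "G \<in> (\<Union>l\<in>{2..}. dumbbell_graphs l n)" by blast
next
  fix G :: "'a ugraph" assume "G \<in> (\<Union>l\<in>{2..}. dumbbell_graphs l n)"
  then obtain l a b C D P u v where *: "l \<ge> 2" "is_cycle a C" "is_cycle b D" "a + b + l = n + 1"
    "verts C \<inter> verts D = {}" "is_path l u v P" "verts P \<inter> verts C = {u}" "verts P \<inter> verts D = {v}"
    "G = graph_union (graph_union C D) P" unfolding dumbbell_graphs_def by auto
  then have "l = n - a - b + 1" "a + b < n" by auto
  then show "G \<in> B1_2 n" unfolding B1_2_def using * by blast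
qed

text \<open>Any two vertices of a triangle are adjacent. This recovers the bound
  \<open>4 \<le> a\<close> of \<open>B3_2\<close>, which \<open>theta_graphs\<close> does not
  state.\<close>

lemma nonadjacent_cycle_length:
  assumes "is_cycle a C" "u \<in> verts C" "v \<in> verts C" "u \<noteq> v" "{u, v} \<notin> edges C"
  shows "a \<ge> 4"
proof (rule ccontr)
  assume "\<not> a \<ge> 4"
  moreover obtain xs where "length xs = a" "a \<ge> 3" "C = UGraph (set xs) (cycle_edges xs)"
    using assms(1) unfolding is_cycle_iff by auto
  moreover from calculation have "length xs = 3" by simp
  then obtain x y z where "xs = [x, y, z]"
    by (cases xs; cases "tl xs"; cases "tl (tl xs)") auto
  ultimately show False using assms(2-5) by (auto simp: cycle_edges_def insert_commute)
qed

lemma B3_2_eq: "B3_2 n = (\<Union>l\<in>{2..}. theta_graphs l n)"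
proof (intro equalityI subsetI)
  fix G :: "'a ugraph" assume "G \<in> B3_2 n"
  then obtain a C P u v where *: "4 \<le> a" "a \<le> n - 1" "is_cycle a C" "u \<in> verts C" "v \<in> verts C"
    "u \<noteq> v" "{u, v} \<notin> edges C" "is_path (n - a + 1) u v P" "verts P \<inter> verts C = {u, v}"
    "G = graph_union C P" unfolding B3_2_def by auto
  have "a + (n - a + 1) = n + 1" using *(1,2) by simp
  then have "G \<in> theta_graphs (n - a + 1) n" unfolding theta_graphs_def using * by blast
  moreover have "n - a + 1 \<in> {2..}" using *(1,2) by simp
  ultimately show "G \<in> (\<Union>l\<in>{2..}. theta_graphs l n)" by blast
next
  fix G :: "'a ugraph" assume "G \<in> (\<Union>l\<in>{2..}. theta_graphs l n)"
  then obtain l a C P u v where *: "l \<ge> 2" "is_cycle a C" "u \<in> verts C" "v \<in> verts C"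
    "u \<noteq> v" "{u, v} \<notin> edges C" "is_path l u v P" "verts P \<inter> verts C = {u, v}" "a + l = n + 1"
    "G = graph_union C P" unfolding theta_graphs_def by auto
  then have "l = n - a + 1" "a \<le> n - 1" by auto
  moreover have "4 \<le> a" using nonadjacent_cycle_length[OF *(2-6)] .
  ultimately show "G \<in> B3_2 n" unfolding B3_2_def using * by blast
qed

section \<open>Theta graphs as three paths: isomorphism and existence\<close>

text \<open>The lists \<open>p\<close>, \<open>q\<close>, \<open>r\<close> hold the interior vertices of the three paths joining \<open>u\<close> and \<open>v\<close>.\<close>

definition theta_list :: "'a \<Rightarrow> 'a \<Rightarrow> 'a list \<Rightarrow> 'a list \<Rightarrow> 'a list \<Rightarrow> 'a ugraph" where
  "theta_list u v p q r = UGraph (set (u # v # p @ q @ r))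
     (path_edges (u # p @ [v]) \<union> path_edges (u # q @ [v]) \<union> path_edges (u # r @ [v]))"

lemma path_edges_join: "path_edges (xs @ v # ys) = path_edges (xs @ [v]) \<union> path_edges (v # ys)"
  using path_edges_append[of xs "v # ys"] path_edges_append[of xs "[v]"] by (cases "xs = []") auto

lemma cycle_edges_rotate: "cycle_edges (xs @ ys) = cycle_edges (ys @ xs)"
proof (cases "xs = [] \<or> ys = []")
  case False
  then show ?thesis unfolding cycle_edges_def
    by (simp add: path_edges_append insert_commute Un_commute)
qed auto

text \<open>The second arc is reversed so that both arcs run from \<open>u\<close> to
  \<open>v\<close>.\<close>

lemma cycle_edges_split:
  "cycle_edges (u # p @ v # q) = path_edges (u # p @ [v]) \<union> path_edges (u # rev q @ [v])"
proof -
  have "path_edges (u # rev q @ [v]) = path_edges (v # q @ [u])"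
    using path_edges_rev[of "v # q @ [u]"] by simp
  also have "\<dots> = insert {last (v # q), u} (path_edges (v # q))"
    using path_edges_append[of "v # q" "[u]"] by simp
  finally show ?thesis
    using path_edges_join[of "u # p" v q] by (simp add: cycle_edges_def)
qed

text \<open>Rotate the cycle to start at \<open>u\<close> and cut it at \<open>v\<close>. Both arcs
  have interior vertices because \<open>u\<close> and \<open>v\<close> are not adjacent on the
  cycle; \<open>r\<close> is empty exactly for a chord.\<close>

lemma theta_graphs_list:
  assumes "G \<in> theta_graphs l n"
  obtains u v p q r where "distinct (u # v # p @ q @ r)" "p \<noteq> []" "q \<noteq> []" "Suc (length r) = l"
    "length p + length q + length r + 2 = n" "G = theta_list u v p q r"
proof -
  obtain a C P u v where C: "is_cycle a C" and uv: "u \<in> verts C" "v \<in> verts C" "u \<noteq> v"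
     "{u, v} \<notin> edges C" and P: "is_path l u v P" "verts P \<inter> verts C = {u, v}" and n: "a + l = n + 1"
     and G: "G = graph_union C P" using assms unfolding theta_graphs_def by auto
  obtain xs where xs: "distinct xs" "length xs = a" "C = UGraph (set xs) (cycle_edges xs)"
    using C unfolding is_cycle_iff by auto
  then obtain as bs where ab: "xs = as @ u # bs" using uv(1) by (auto dest: split_list)
  have "v \<in> set (bs @ as)" using uv(2,3) xs(3) ab by auto
  then obtain p q where pq: "bs @ as = p @ v # q" by (metis split_list)
  have ce: "cycle_edges xs = path_edges (u # p @ [v]) \<union> path_edges (u # rev q @ [v])"
    using cycle_edges_rotate[of as "u # bs"] cycle_edges_split[of u p v q] ab pq by simp
  have "distinct (u # bs @ as)" "set xs = set (u # bs @ as)" "a = length (u # bs @ as)"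
    using xs(1,2) ab by auto
  then have dC: "distinct (u # p @ v # q)" and sC: "set xs = set (u # p @ v # q)"
    and lC: "a = length p + length q + 2" unfolding pq by auto
  have "{u, v} \<notin> path_edges (u # p @ [v])" "{u, v} \<notin> path_edges (u # rev q @ [v])"
    using uv(4) unfolding xs(3) ugraph.sel ce by simp_all
  then have pq0: "p \<noteq> []" "q \<noteq> []" by (auto intro: ccontr)
  obtain ws where ws: "distinct ws" "length ws = Suc l" "hd ws = u" "last ws = v"
    "P = UGraph (set ws) (path_edges ws)" using P(1) unfolding is_path_iff by auto
  obtain ws' where ws': "ws = u # ws'" using ws(2,3) by (cases ws) auto
  then have "ws' \<noteq> []" using ws(4) uv(3) by auto
  then obtain r where r: "ws = u # r @ [v]" using ws' ws(4) by (metis append_butlast_last_id last_ConsR)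
  have "distinct (u # v # p @ rev q @ r)"
    using ws(1) r dC P(2) ws(5) xs(3) sC by auto
  moreover have "G = theta_list u v p (rev q) r"
    unfolding G theta_list_def graph_union_def using xs(3) sC ce ws(5) r by auto
  moreover have "Suc (length r) = l" using ws(2) r by simp
  moreover have "length p + length (rev q) + length r + 2 = n"
    using lC n \<open>Suc (length r) = l\<close> by simp
  ultimately show ?thesis using that[of u v p "rev q" r] pq0 by auto
qed

text \<open>Matching the two vertex lists position by position is an isomorphism: equal lengths
  align the three paths, and \<open>path_edges_map\<close> transports their edges.\<close>

lemma theta_list_iso:
  assumes "distinct (u # v # p @ q @ r)" "distinct (u' # v' # p' @ q' @ r')"
    and len: "length p = length p'" "length q = length q'" "length r = length r'"
  shows "graph_iso (theta_list u v p q r) (theta_list u' v' p' q' r')"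
proof -
  let ?L = "u # v # p @ q @ r" and ?L' = "u' # v' # p' @ q' @ r'"
  define f where "f x = the (map_of (zip ?L ?L') x)" for x
  have f: "map f ?L = ?L'"
  proof (rule nth_equalityI)
    show "length (map f ?L) = length ?L'" using len by simp
    fix i assume "i < length (map f ?L)"
    then have "i < length ?L" by (simp only: length_map)
    moreover have "length ?L = length ?L'" using len by simp
    ultimately have "map_of (zip ?L ?L') (?L ! i) = Some (?L' ! i)"
      using assms(1) by (intro map_of_zip_nth) auto
    then show "map f ?L ! i = ?L' ! i" using \<open>i < length ?L\<close>
      by (simp only: nth_map f_def option.sel)
  qed
  then have m: "f u = u'" "f v = v'" "map f p = p'" "map f q = q'" "map f r = r'"
    using len by auto
  have "bij_betw f (set ?L) (set ?L')"
    using f assms(2) distinct_map[of f ?L] set_map[of f ?L] unfolding bij_betw_def by metis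
  moreover have "path_edges (u' # ys' @ [v']) = (`) f ` path_edges (u # ys @ [v])"
    if "map f ys = ys'" for ys ys'
    using path_edges_map[of f "u # ys @ [v]"] m that by simp
  then have "path_edges (u' # p' @ [v']) = (`) f ` path_edges (u # p @ [v])"
    "path_edges (u' # q' @ [v']) = (`) f ` path_edges (u # q @ [v])"
    "path_edges (u' # r' @ [v']) = (`) f ` path_edges (u # r @ [v])" using m by blast+
  ultimately show ?thesis unfolding graph_iso_def theta_list_def ugraph.sel image_Un by metis
qed

lemma unique_up_to_iso_theta:
  assumes "S \<noteq> {}" and "\<And>G. G \<in> S \<Longrightarrow> \<exists>u v p q r. distinct (u # v # p @ q @ r) \<and> length p = i \<and>
    length q = j \<and> length r = k \<and> G = theta_list u v p q r"
  shows "unique_up_to_iso S"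
  unfolding unique_up_to_iso_def
proof (intro conjI ballI)
  fix G H assume "G \<in> S" "H \<in> S"
  obtain u v p q r where *: "distinct (u # v # p @ q @ r)" "length p = i" "length q = j"
    "length r = k" "G = theta_list u v p q r" using assms(2)[OF \<open>G \<in> S\<close>] by auto
  obtain u' v' p' q' r' where **: "distinct (u' # v' # p' @ q' @ r')" "length p' = i" "length q' = j"
    "length r' = k" "H = theta_list u' v' p' q' r'" using assms(2)[OF \<open>H \<in> S\<close>] by auto
  show "graph_iso G H" unfolding *(5) **(5)
    by (rule theta_list_iso[OF *(1) **(1)]) (use * ** in auto)
qed (rule assms(1))

lemma theta_list_swap:
  "theta_list u v p q r = theta_list u v q p r" "theta_list u v p q r = theta_list u v p r q"
  unfolding theta_list_def by auto

text \<open>Among n vertices, supplied by the infinite type, the first a = n + 1 - l form a cycle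
  and the others the interior of a path from its first to its third vertex. These two are not
  adjacent on the cycle since a >= 4.\<close>

lemma theta_graphs_nonempty:
  assumes "infinite (UNIV :: 'a set)" "l \<ge> 1" "n \<ge> l + 3"
  shows "(theta_graphs l n :: 'a ugraph set) \<noteq> {}"
proof -
  obtain B :: "'a set" where "finite B" "card B = n"
    using infinite_arbitrarily_large[OF assms(1)] by metis
  then obtain ws :: "'a list" where ws: "distinct ws" "length ws = n"
    using finite_distinct_list[of B] distinct_card by metis
  define a where "a = n + 1 - l"
  have a: "a \<ge> 4" "a \<le> n" "a + l = n + 1" using assms(2,3) unfolding a_def by auto
  define cs where "cs = take a ws"
  define ds where "ds = drop a ws"
  have cd: "distinct (cs @ ds)" "length cs = a" "length ds + 1 = l"
    using ws a unfolding cs_def ds_def by auto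
  obtain x y z t rest where cs: "cs = x # y # z # t # rest"
    using cd(2) a(1) by (cases cs; cases "tl cs"; cases "tl (tl cs)"; cases "tl (tl (tl cs))") auto
  have d: "distinct (x # y # z # t # rest @ ds)" using cd(1) cs by simp
  have last: "last (t # rest) \<in> set (t # rest)" by (rule last_in_set) simp
  have "{x, z} \<noteq> {last (t # rest), x}" "{x, z} \<noteq> {x, y}" "{x, z} \<noteq> {y, z}"
    using d last by (auto simp: doubleton_eq_iff)
  moreover have "{x, z} \<notin> path_edges (z # t # rest)"
    using path_edges_subset[of "{x, z}" "z # t # rest"] d by auto
  ultimately have na: "{x, z} \<notin> cycle_edges cs" unfolding cs cycle_edges_def by simp
  define P where "P = UGraph (set (x # ds @ [z])) (path_edges (x # ds @ [z]))"
  have path: "is_path l x z P" unfolding is_path_iff P_def using cd(3) d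
    by (intro exI[of _ "x # ds @ [z]"]) auto
  have cyc: "is_cycle a (UGraph (set cs) (cycle_edges cs))"
    unfolding is_cycle_iff using cd(1,2) a(1) by auto
  have inter: "verts P \<inter> verts (UGraph (set cs) (cycle_edges cs)) = {x, z}"
    using d cs by (auto simp: P_def)
  have "graph_union (UGraph (set cs) (cycle_edges cs)) P \<in> theta_graphs l n"
  proof (rule theta_graphsI[OF cyc _ _ _ _ path inter a(3)])
    show "x \<in> verts (UGraph (set cs) (cycle_edges cs))" "z \<in> verts (UGraph (set cs) (cycle_edges cs))"
      using cs by auto
    show "x \<noteq> z" using d by simp
    show "{x, z} \<notin> edges (UGraph (set cs) (cycle_edges cs))" using na by simp
  qed
  then show ?thesis by (rule contrapos_pn) simp
qed

section \<open>Values on the families, ranking, and small orders\<close>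

lemma two_cubic_of_adjacent_family:
  assumes "G \<in> B1_1 n \<union> B3_1 n"
  obtains u v where "two_cubic n G u v" "{u, v} \<in> edges G"
  using assms theta_graphs_two_cubic[of G 1 n] dumbbell_graphs_two_cubic[of G 1 n]
  unfolding B1_1_eq B3_1_eq by auto

lemma two_cubic_of_nonadjacent_family:
  assumes "G \<in> B1_2 n \<union> B3_2 n"
  obtains u v where "two_cubic n G u v" "{u, v} \<notin> edges G"
proof -
  obtain l where l: "l \<ge> 2" "G \<in> theta_graphs l n \<or> G \<in> dumbbell_graphs l n"
    using assms unfolding B1_2_eq B3_2_eq by auto
  then show ?thesis using theta_graphs_two_cubic[of G l n] dumbbell_graphs_two_cubic[of G l n] that
    by auto
qed

lemma two_cubic_in_families:
  assumes "two_cubic n G u v"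
  shows "G \<in> B1_1 n \<union> B3_1 n \<or> G \<in> B1_2 n \<union> B3_2 n"
proof -
  obtain l where "l = 1 \<or> l \<ge> 2" "G \<in> theta_graphs l n \<union> dumbbell_graphs l n"
    using two_cubic_imp_family[OF assms] by (auto split: if_splits)
  then show ?thesis unfolding B1_1_eq B3_1_eq B1_2_eq B3_2_eq by auto
qed

lemma sum_connectivity_adjacent_family:
  assumes "G \<in> B1_1 n \<union> B3_1 n"
  shows "bicyclic n G" "sum_connectivity G = (real n - 4) / 2 + 1 / sqrt 6 + 4 / sqrt 5"
proof -
  obtain u v where uv: "two_cubic n G u v" "{u, v} \<in> edges G"
    using two_cubic_of_adjacent_family[OF assms] .
  then show "bicyclic n G" by (simp add: two_cubic_def)
  have "6 / sqrt 5 - 2 / sqrt 5 = 4 / sqrt 5" by (simp flip: diff_divide_distrib)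
  then show "sum_connectivity G = (real n - 4) / 2 + 1 / sqrt 6 + 4 / sqrt 5"
    using sum_connectivity_two_cubic[OF uv(1)] uv(2) by (simp add: diff_divide_distrib)
qed

lemma sum_connectivity_nonadjacent_family:
  assumes "G \<in> B1_2 n \<union> B3_2 n"
  shows "bicyclic n G" "sum_connectivity G = (real n - 5) / 2 + 6 / sqrt 5"
proof -
  obtain u v where uv: "two_cubic n G u v" "{u, v} \<notin> edges G"
    using two_cubic_of_nonadjacent_family[OF assms] .
  then show "bicyclic n G" by (simp add: two_cubic_def)
  show "sum_connectivity G = (real n - 5) / 2 + 6 / sqrt 5"
    using sum_connectivity_two_cubic[OF uv(1)] uv(2) by simp
qed

text \<open>Purely order-theoretic ranking. Both sets must be nonempty for their values to be
  attained; with \<open>M\<close> empty, \<open>s\<close> itself would be the maximum.\<close>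

lemma max_and_second_max_graphs:
  fixes M S :: "'a ugraph set"
  assumes M: "M \<noteq> {}" "\<And>G. G \<in> M \<Longrightarrow> bicyclic n G \<and> sum_connectivity G = m"
    and S: "S \<noteq> {}" "\<And>G. G \<in> S \<Longrightarrow> bicyclic n G \<and> sum_connectivity G = s"
    and "s < m" and rest: "\<And>G. bicyclic n G \<Longrightarrow> G \<in> M \<or> G \<in> S \<or> sum_connectivity G < s"
  shows "max_graphs n = M" "second_max_graphs n = S"
proof -
  have le: "sum_connectivity G \<le> m" if "bicyclic n G" for G :: "'a ugraph"
    using rest[OF that] M(2)[of G] S(2)[of G] \<open>s < m\<close> by auto
  obtain G0 where G0: "G0 \<in> M" using M(1) by auto
  show max: "max_graphs n = M"
  proof (intro equalityI subsetI)
    fix G :: "'a ugraph" assume "G \<in> max_graphs n"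
    then have "bicyclic n G" "m \<le> sum_connectivity G"
      using M(2)[OF G0] unfolding max_graphs_def is_arg_max_linorder by auto
    then show "G \<in> M" using rest[of G] S(2)[of G] \<open>s < m\<close> by auto
  next
    fix G :: "'a ugraph" assume G: "G \<in> M"
    then show "G \<in> max_graphs n"
      using M(2)[OF G] le unfolding max_graphs_def is_arg_max_linorder by (auto simp: not_less)
  qed
  obtain G1 where G1: "G1 \<in> S" using S(1) by auto
  have SM: "G \<notin> M" if "G \<in> S" for G using M(2)[of G] S(2)[OF that] \<open>s < m\<close> by auto
  show "second_max_graphs n = S"
  proof (intro equalityI subsetI)
    fix G :: "'a ugraph" assume "G \<in> second_max_graphs n"
    then have "bicyclic n G" "G \<notin> M" "s \<le> sum_connectivity G"
      using S(2)[OF G1] SM[OF G1] unfolding second_max_graphs_def is_arg_max_linorder max by auto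
    then show "G \<in> S" using rest[of G] by auto
  next
    fix G :: "'a ugraph" assume G: "G \<in> S"
    have "sum_connectivity H \<le> s" if "bicyclic n H" "H \<notin> M" for H :: "'a ugraph"
      using rest[OF that(1)] that(2) S(2)[of H] by auto
    then show "G \<in> second_max_graphs n"
      using S(2)[OF G] SM[OF G] unfolding second_max_graphs_def is_arg_max_linorder max
      by (auto simp: not_less)
  qed
qed

text \<open>Two disjoint cycles take at least six vertices, and the path adds l - 1 more.\<close>

lemma dumbbell_graphs_order:
  fixes G :: "'a ugraph"
  assumes "G \<in> dumbbell_graphs l n"
  shows "n + 1 \<ge> l + 6"
proof -
  note assms
  then obtain a b and C D :: "'a ugraph" where "is_cycle a C" "is_cycle b D" "a + b + l = n + 1"
    unfolding dumbbell_graphs_def by blast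
  then show ?thesis unfolding is_cycle_iff by auto
qed

lemma B1_1_empty: "n < 6 \<Longrightarrow> B1_1 n = {}"
  unfolding B1_1_eq by (auto dest: dumbbell_graphs_order)

lemma B1_2_empty: "n < 7 \<Longrightarrow> B1_2 n = {}"
  unfolding B1_2_eq by (auto dest: dumbbell_graphs_order)

lemma B3_1_nonempty: "infinite (UNIV :: 'a set) \<Longrightarrow> n \<ge> 4 \<Longrightarrow> (B3_1 n :: 'a ugraph set) \<noteq> {}"
  using theta_graphs_nonempty[of 1 n] unfolding B3_1_eq by simp

lemma B3_2_nonempty:
  assumes "infinite (UNIV :: 'a set)" "n \<ge> 5"
  shows "(B3_2 n :: 'a ugraph set) \<noteq> {}"
proof -
  have "(theta_graphs 2 n :: 'a ugraph set) \<noteq> {}" using theta_graphs_nonempty[of 2 n] assms by simp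
  then show ?thesis unfolding B3_2_eq by fastforce
qed

text \<open>One of the three paths is the chord, so the other three vertices are split between two
  nonempty interiors: 3 = 2 + 1.\<close>

lemma B3_1_5_unique:
  assumes "infinite (UNIV :: 'a set)"
  shows "unique_up_to_iso (B3_1 5 :: 'a ugraph set)"
proof (rule unique_up_to_iso_theta)
  show "(B3_1 5 :: 'a ugraph set) \<noteq> {}" using B3_1_nonempty[OF assms] by simp
  fix G :: "'a ugraph" assume "G \<in> B3_1 5"
  then have "G \<in> theta_graphs 1 5" unfolding B3_1_eq .
  then obtain u v p q r where *: "distinct (u # v # p @ q @ r)" "p \<noteq> []" "q \<noteq> []" "Suc (length r) = 1"
    "length p + length q + length r + 2 = 5" "G = theta_list u v p q r" by (rule theta_graphs_list)
  have "length p \<ge> 1" "length q \<ge> 1" using *(2,3) by (simp_all add: Suc_le_eq)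
  then consider "length p = 2 \<and> length q = 1 \<and> length r = 0" | "length q = 2 \<and> length p = 1 \<and> length r = 0"
    using *(4,5) by linarith
  then show "\<exists>u v p q r. distinct (u # v # p @ q @ r) \<and> length p = 2 \<and> length q = 1 \<and>
    length r = 0 \<and> G = theta_list u v p q r"
  proof cases
    case 1
    then show ?thesis using *(1,6) by blast
  next
    case 2
    moreover have "distinct (u # v # q @ p @ r)" using *(1) by auto
    ultimately show ?thesis using *(6) theta_list_swap(1)[of u v p q r] by blast
  qed
qed

lemma B3_2_lengths:
  assumes "G \<in> B3_2 n"
  obtains u v p q r where "distinct (u # v # p @ q @ r)" "length p \<ge> 1" "length q \<ge> 1" "length r \<ge> 1"
    "length p + length q + length r + 2 = n" "G = theta_list u v p q r"
proof -
  obtain l where l: "l \<ge> 2" "G \<in> theta_graphs l n" using assms unfolding B3_2_eq by auto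
  obtain u v p q r where *: "distinct (u # v # p @ q @ r)" "p \<noteq> []" "q \<noteq> []" "Suc (length r) = l"
    "length p + length q + length r + 2 = n" "G = theta_list u v p q r"
    using theta_graphs_list[OF l(2)] .
  have "length p \<ge> 1" "length q \<ge> 1" "length r \<ge> 1"
    using *(2-4) l(1) by (cases p; cases q; simp)+
  then show ?thesis using that[OF *(1) _ _ _ *(5,6)] by simp
qed

text \<open>The only split of three interior vertices into three nonempty parts is 1 + 1 +
  1.\<close>

lemma B3_2_5_unique:
  assumes "infinite (UNIV :: 'a set)"
  shows "unique_up_to_iso (B3_2 5 :: 'a ugraph set)"
proof (rule unique_up_to_iso_theta)
  show "(B3_2 5 :: 'a ugraph set) \<noteq> {}" using B3_2_nonempty[OF assms] by simp
  fix G :: "'a ugraph" assume "G \<in> B3_2 5"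
  then obtain u v p q r where *: "distinct (u # v # p @ q @ r)" "length p \<ge> 1" "length q \<ge> 1"
    "length r \<ge> 1" "length p + length q + length r + 2 = 5" "G = theta_list u v p q r"
    by (rule B3_2_lengths)
  then have "length p = 1 \<and> length q = 1 \<and> length r = 1" by linarith
  with * show "\<exists>u v p q r. distinct (u # v # p @ q @ r) \<and> length p = 1 \<and> length q = 1 \<and>
    length r = 1 \<and> G = theta_list u v p q r" by blast
qed

text \<open>Up to order, the only split of four interior vertices into three nonempty parts is 2 + 1
  + 1; \<open>theta_list_swap\<close> moves the longer part to the front.\<close>

lemma B3_2_6_unique:
  assumes "infinite (UNIV :: 'a set)"
  shows "unique_up_to_iso (B3_2 6 :: 'a ugraph set)"
proof (rule unique_up_to_iso_theta)
  show "(B3_2 6 :: 'a ugraph set) \<noteq> {}" using B3_2_nonempty[OF assms] by simp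
  fix G :: "'a ugraph" assume "G \<in> B3_2 6"
  then obtain u v p q r where *: "distinct (u # v # p @ q @ r)" "length p \<ge> 1" "length q \<ge> 1"
    "length r \<ge> 1" "length p + length q + length r + 2 = 6" "G = theta_list u v p q r"
    by (rule B3_2_lengths)
  then consider "length p = 2 \<and> length q = 1 \<and> length r = 1" | "length q = 2 \<and> length p = 1 \<and> length r = 1"
    | "length r = 2 \<and> length p = 1 \<and> length q = 1"
    by linarith
  then show "\<exists>u v p q r. distinct (u # v # p @ q @ r) \<and> length p = 2 \<and> length q = 1 \<and>
    length r = 1 \<and> G = theta_list u v p q r"
  proof cases
    case 1
    then show ?thesis using *(1,6) by blast
  next
    case 2
    moreover have "distinct (u # v # q @ p @ r)" using *(1) by auto
    ultimately show ?thesis using *(6) theta_list_swap(1)[of u v p q r] by blast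
  next
    case 3
    moreover have "distinct (u # v # r @ p @ q)" using *(1) by auto
    moreover have "G = theta_list u v r p q"
      using *(6) theta_list_swap(2)[of u v p q r] theta_list_swap(1)[of u v p r q] by simp
    ultimately show ?thesis by blast
  qed
qed

theorem theorem4:
  fixes n :: nat
  assumes "infinite (UNIV :: 'a set)" and "n \<ge> 5"
  shows "(n = 5 \<longrightarrow>
            (max_graphs n :: 'a ugraph set) = B3_1 n \<and>
            unique_up_to_iso (B3_1 n :: 'a ugraph set) \<and>
            (second_max_graphs n :: 'a ugraph set) = B3_2 n \<and>
            unique_up_to_iso (B3_2 n :: 'a ugraph set)) \<and>
         (n = 6 \<longrightarrow>
            (max_graphs n :: 'a ugraph set) = B1_1 n \<union> B3_1 n \<and>
            (second_max_graphs n :: 'a ugraph set) = B3_2 n \<and>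
            unique_up_to_iso (B3_2 n :: 'a ugraph set)) \<and>
         (n \<ge> 7 \<longrightarrow>
            (max_graphs n :: 'a ugraph set) = B1_1 n \<union> B3_1 n \<and>
            (second_max_graphs n :: 'a ugraph set) = B1_2 n \<union> B3_2 n) \<and>
         (\<forall>G \<in> (B1_1 n \<union> B3_1 n :: 'a ugraph set).
            sum_connectivity G = (real n - 4) / 2 + 1 / sqrt 6 + 4 / sqrt 5) \<and>
         (\<forall>H \<in> (B1_2 n \<union> B3_2 n :: 'a ugraph set).
            sum_connectivity H = (real n - 5) / 2 + 6 / sqrt 5)"
proof -
  let ?M = "B1_1 n \<union> B3_1 n :: 'a ugraph set" and ?S = "B1_2 n \<union> B3_2 n :: 'a ugraph set"
  let ?m = "(real n - 4) / 2 + 1 / sqrt 6 + 4 / sqrt 5" and ?s = "(real n - 5) / 2 + 6 / sqrt 5"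
  \<comment> \<open>The two values differ by exactly the constant of
    \<open>adjacent_cubic_gain\<close>.\<close>
  have "6 / sqrt 5 - 2 / sqrt 5 = 4 / sqrt 5" by (simp flip: diff_divide_distrib)
  then have lt: "?s < ?m" using adjacent_cubic_gain by (simp add: diff_divide_distrib)
  have ne: "?M \<noteq> {}" "?S \<noteq> {}"
    using B3_1_nonempty[OF assms(1), of n] B3_2_nonempty[OF assms(1), of n] assms(2) by simp_all
  have rest: "G \<in> ?M \<or> G \<in> ?S \<or> sum_connectivity G < ?s" if "bicyclic n G" for G
  proof (rule bicyclic_bound[OF that])
    show "n \<ge> 2" using assms(2) by simp
  qed (use two_cubic_in_families[of n G] in auto)
  have M: "bicyclic n G \<and> sum_connectivity G = ?m" if "G \<in> ?M" for G
    using sum_connectivity_adjacent_family[OF that] by simp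
  have S: "bicyclic n G \<and> sum_connectivity G = ?s" if "G \<in> ?S" for G
    using sum_connectivity_nonadjacent_family[OF that] by simp
  \<comment> \<open>One ranking serves all n >= 5: the dumbbell families that the claim omits for n
    = 5 and n = 6 are empty.\<close>
  have ms: "max_graphs n = ?M" "second_max_graphs n = ?S"
    by (rule max_and_second_max_graphs[OF ne(1) _ ne(2) _ lt]; use M S rest in blast)+
  show ?thesis
    unfolding ms
  proof (intro conjI impI ballI)
    assume "n = 5"
    then show "unique_up_to_iso (B3_1 n :: 'a ugraph set)" "unique_up_to_iso (B3_2 n :: 'a ugraph set)"
      using B3_1_5_unique[OF assms(1)] B3_2_5_unique[OF assms(1)] by simp_all
  next
    assume "n = 6"
    then show "unique_up_to_iso (B3_2 n :: 'a ugraph set)" using B3_2_6_unique[OF assms(1)] by simp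
  qed (simp_all add: B1_1_empty B1_2_empty M S)
qed

end
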